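(* Let $G=\{N\in U(2m+1,\mathbb{F}_{q^2}) : N^TJ_{2m+1}\bar N=J_{2m+1}\}$ be the Sylow $p$-subgroup of $GU(2m+1,q^2)$ consisting of its lower unitriangular matrices. For $k\ge1$ let $h_k=\sum_{i=1}^m\left(x_{2m+2-i}^{q^{2k-1}}x_i+x_{2m+2-i}x_i^{q^{2k-1}}\right)+x_{m+1}^{q^{2k-1}+1}$. Then the invariant field $\mathbb{F}_{q^2}(V)^G$ is generated by the polynomials $N(x_j)$, $j=1,\dots,m+1$, and $h_k$, $k=1,\dots,m$; i.e. $$\mathbb{F}_{q^2}(V)^G=\mathbb{F}_{q^2}(x_1,N(x_2),\dots,N(x_{m+1}),h_1,\dots,h_{m}).$$
   Context: $q$ is a power of a prime $p$, $m\ge 1$, $V=\mathbb{F}_{q^2}^{2m+1}$ (column vectors) with $x_1,\dots,x_{2m+1}$ the dual basis of the standard basis; $\mathbb{F}_{q^2}[V]=\mathbb{F}_{q^2}[x_1,\dots,x_{2m+1}]$, $\mathbb{F}_{q^2}(V)$ is its fraction field, and $G$ acts by $(g\cdot f)(v)=f(g^{-1}v)$. $N(x_j)=\prod_{y\in G\cdot x_j}y$ is the product over the $G$-orbit of $x_j$ (so $N(x_1)=x_1$). $U(n,\mathbb{F})$ is the group of lower triangular $n\times n$ matrices over $\mathbb{F}$ with ones on the diagonal; $\bar N=[n_{ij}^q]$; $J_n$ is the $n\times n$ matrix with ones on the antidiagonal and zeros elsewhere; $GU(2m+1,q^2)=\{M\in GL_{2m+1}(\mathbb{F}_{q^2}):M^TJ_{2m+1}\bar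 M=J_{2m+1}\}$. *)

theory Defs
  imports
    "HOL-Library.Poly_Mapping"
    "HOL-Algebra.Generated_Fields"
    "HOL-Algebra.Algebraic_Closure_Type"
    "HOL-Computational_Algebra.Polynomial_Factorial"
    "Jordan_Normal_Form.Matrix"
begin

text \<open>
  Multivariate polynomials over \<open>'a\<close> are finitely supported maps from exponent vectors to
  coefficients. The variables \<open>mvar j\<close> are indexed by all natural numbers; the polynomial ring
  in \<open>x\<^sub>1, \<dots>, x\<^sub>n\<close> is the subset \<open>poly_ring n\<close>, and its fraction field is the subset
  \<open>fun_field n\<close> of the fraction field of the ambient ring.
\<close>

type_synonym 'a mpoly = "(nat \<Rightarrow>\<^sub>0 nat) \<Rightarrow>\<^sub>0 'a"

definition mconst :: "'a::comm_ring_1 \<Rightarrow> 'a mpoly" where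
  "mconst c = Poly_Mapping.single 0 c"

definition mvar :: "nat \<Rightarrow> 'a::comm_ring_1 mpoly" where
  "mvar j = Poly_Mapping.single (Poly_Mapping.single j 1) 1"

definition poly_ring :: "nat \<Rightarrow> 'a::comm_ring_1 mpoly set" where
  "poly_ring n = {f. \<forall>\<mu>\<in>Poly_Mapping.keys f. Poly_Mapping.keys \<mu> \<subseteq> {1..n}}"

definition fun_field :: "nat \<Rightarrow> 'a::idom mpoly fract set" where
  "fun_field n = {Fraction_Field.Fract a b | a b. a \<in> poly_ring n \<and> b \<in> poly_ring n \<and> b \<noteq> 0}"

definition msubst :: "(nat \<Rightarrow> 'a mpoly) \<Rightarrow> 'a::comm_ring_1 mpoly \<Rightarrow> 'a mpoly" where
  "msubst \<sigma> f = (\<Sum>\<mu>\<in>Poly_Mapping.keys f. mconst (Poly_Mapping.lookup f \<mu>) *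
      (\<Prod>i\<in>Poly_Mapping.keys \<mu>. \<sigma> i ^ Poly_Mapping.lookup \<mu> i))"

text \<open>
  The action \<open>(g \<cdot> f)(v) = f(g\<^sup>-\<^sup>1 v)\<close>: the \<open>j\<close>-th coordinate function is replaced by the
  \<open>j\<close>-th coordinate of \<open>g\<^sup>-\<^sup>1 (x\<^sub>1, \<dots>, x\<^sub>n)\<^sup>T\<close>. Matrix indices start at 0, variable indices at 1.
\<close>

definition poly_act :: "nat \<Rightarrow> 'a::comm_ring_1 mat \<Rightarrow> 'a mpoly \<Rightarrow> 'a mpoly" where
  "poly_act n g = msubst (\<lambda>j. \<Sum>k=1..n.
      mconst ((inv\<^bsub>ring_mat TYPE('a) n ()\<^esub> g) $$ (j - 1, k - 1)) * mvar k)"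

text \<open>
  The induced action on \<open>fun_field n\<close>; \<open>fract_act_Fract\<close> below shows that it is well defined.
\<close>

definition fract_act :: "nat \<Rightarrow> 'a::idom mat \<Rightarrow> 'a mpoly fract \<Rightarrow> 'a mpoly fract" where
  "fract_act n g r = (THE s. \<exists>a\<in>poly_ring n. \<exists>b\<in>poly_ring n. b \<noteq> 0 \<and>
      r = Fraction_Field.Fract a b \<and> s = Fraction_Field.Fract (poly_act n g a) (poly_act n g b))"

context
begin

private lemma mconst_hom:
  "mconst (a + b) = mconst a + mconst b" "mconst (a * b) = mconst a * mconst b"
  "mconst 0 = 0" "mconst 1 = 1"
  by (simp_all add: mconst_def single_add mult_single)

private definition mpow :: "(nat \<Rightarrow> 'a mpoly) \<Rightarrow> (nat \<Rightarrow>\<^sub>0 nat) \<Rightarrow> 'a::comm_ring_1 mpoly" where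
  "mpow \<sigma> \<mu> = (\<Prod>i\<in>Poly_Mapping.keys \<mu>. \<sigma> i ^ Poly_Mapping.lookup \<mu> i)"

private lemma mpow_superset:
  assumes "finite A" "Poly_Mapping.keys \<mu> \<subseteq> A"
  shows "mpow \<sigma> \<mu> = (\<Prod>i\<in>A. \<sigma> i ^ Poly_Mapping.lookup \<mu> i)"
  unfolding mpow_def using assms by (intro prod.mono_neutral_left) (auto simp: in_keys_iff)

private lemma mpow_add: "mpow \<sigma> (\<mu> + \<nu>) = mpow \<sigma> \<mu> * mpow \<sigma> \<nu>"
proof -
  let ?A = "Poly_Mapping.keys \<mu> \<union> Poly_Mapping.keys \<nu>"
  have "Poly_Mapping.keys (\<mu> + \<nu>) \<subseteq> ?A" by (rule keys_add)
  then show ?thesis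
    by (simp add: mpow_superset[of ?A] lookup_add power_add prod.distrib)
qed

private lemma msubst_superset:
  assumes "finite A" "Poly_Mapping.keys f \<subseteq> A"
  shows "msubst \<sigma> f = (\<Sum>\<mu>\<in>A. mconst (Poly_Mapping.lookup f \<mu>) * mpow \<sigma> \<mu>)"
  unfolding msubst_def mpow_def using assms
  by (intro sum.mono_neutral_left) (auto simp: in_keys_iff mconst_hom)

private lemma msubst_0: "msubst \<sigma> 0 = 0"
  by (simp add: msubst_def)

private lemma msubst_add: "msubst \<sigma> (f + g) = msubst \<sigma> f + msubst \<sigma> g"
proof -
  let ?A = "Poly_Mapping.keys f \<union> Poly_Mapping.keys g"
  have "Poly_Mapping.keys (f + g) \<subseteq> ?A" by (rule keys_add)
  then show ?thesis
    by (simp add: msubst_superset[of ?A] lookup_add mconst_hom sum.distrib algebra_simps)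
qed

private lemma msubst_sum: "msubst \<sigma> (\<Sum>i\<in>I. F i) = (\<Sum>i\<in>I. msubst \<sigma> (F i))"
  by (induction I rule: infinite_finite_induct) (simp_all add: msubst_0 msubst_add)

private lemma msubst_single: "msubst \<sigma> (Poly_Mapping.single \<mu> c) = mconst c * mpow \<sigma> \<mu>"
  by (subst msubst_superset[of "{\<mu>}"]) auto

private lemma sum_singles:
  "(\<Sum>\<mu>\<in>Poly_Mapping.keys f. Poly_Mapping.single \<mu> (Poly_Mapping.lookup f \<mu>)) = f"
  by (rule poly_mapping_eqI)
    (simp add: lookup_sum lookup_single when_def in_keys_iff)

private lemma msubst_mult: "msubst \<sigma> (f * g) = msubst \<sigma> f * msubst \<sigma> g"
proof -
  have single: "msubst \<sigma> (Poly_Mapping.single \<mu> c * Poly_Mapping.single \<nu> d)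
      = msubst \<sigma> (Poly_Mapping.single \<mu> c) * msubst \<sigma> (Poly_Mapping.single \<nu> d)" for \<mu> \<nu> c d
    by (simp add: mult_single msubst_single mconst_hom mpow_add algebra_simps)
  have "msubst \<sigma> ((\<Sum>\<mu>\<in>A. Poly_Mapping.single \<mu> (c \<mu>)) * (\<Sum>\<nu>\<in>B. Poly_Mapping.single \<nu> (d \<nu>)))
      = msubst \<sigma> (\<Sum>\<mu>\<in>A. Poly_Mapping.single \<mu> (c \<mu>)) * msubst \<sigma> (\<Sum>\<nu>\<in>B. Poly_Mapping.single \<nu> (d \<nu>))"
    for A B c d
    by (simp add: sum_product msubst_sum single)
  from this[where A = "Poly_Mapping.keys f" and c = "Poly_Mapping.lookup f"
      and B = "Poly_Mapping.keys g" and d = "Poly_Mapping.lookup g"]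
  show ?thesis by (simp only: sum_singles)
qed

private lemma msubst_power: "msubst \<sigma> (f ^ k) = msubst \<sigma> f ^ k"
  by (induction k)
    (simp_all add: msubst_mult msubst_single[of \<sigma> 0 1, simplified] mconst_hom mpow_def)

private lemma msubst_prod: "msubst \<sigma> (\<Prod>i\<in>I. F i) = (\<Prod>i\<in>I. msubst \<sigma> (F i))"
  by (induction I rule: infinite_finite_induct)
    (simp_all add: msubst_mult msubst_single[of \<sigma> 0 1, simplified] mconst_hom mpow_def)

private lemma msubst_mconst: "msubst \<sigma> (mconst c) = mconst c"
  by (simp add: mconst_def[of c] msubst_single) (simp add: mpow_def mconst_def)

private lemma msubst_mvar: "msubst \<sigma> (mvar j) = \<sigma> j"
  by (simp add: mvar_def msubst_single mconst_hom) (simp add: mpow_def)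

private lemma mvar_power: "mvar j ^ k = Poly_Mapping.single (Poly_Mapping.single j k) 1"
  by (induction k) (simp_all add: mvar_def mult_single flip: single_add)

private lemma mpow_mvar: "mpow mvar \<mu> = Poly_Mapping.single \<mu> 1"
proof -
  have "(\<Prod>i\<in>I. Poly_Mapping.single (F i) (1::'a)) = Poly_Mapping.single (\<Sum>i\<in>I. F i) 1"
    for I :: "nat set" and F :: "nat \<Rightarrow> nat \<Rightarrow>\<^sub>0 nat"
    by (induction I rule: infinite_finite_induct) (simp_all add: mult_single)
  then show ?thesis
    by (simp add: mpow_def mvar_power sum_singles)
qed

private lemma msubst_mvar_id: "msubst mvar f = f"
proof -
  have "msubst mvar f = (\<Sum>\<mu>\<in>Poly_Mapping.keys f. mconst (Poly_Mapping.lookup f \<mu>) * mpow mvar \<mu>)"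
    by (simp add: msubst_def mpow_def)
  also have "\<dots> = f"
    by (simp add: mpow_mvar mconst_def mult_single sum_singles)
  finally show ?thesis .
qed

private lemma msubst_comp: "msubst \<sigma> (msubst \<tau> f) = msubst (\<lambda>j. msubst \<sigma> (\<tau> j)) f"
  unfolding msubst_def[of \<tau>] msubst_def[of "\<lambda>j. msubst \<sigma> (\<tau> j)"]
  by (simp add: msubst_sum msubst_mult msubst_mconst msubst_prod msubst_power)

private lemma msubst_cong:
  assumes "f \<in> poly_ring n" "\<And>j. j \<in> {1..n} \<Longrightarrow> \<sigma> j = \<tau> j"
  shows "msubst \<sigma> f = msubst \<tau> f"
  unfolding msubst_def using assms
  by (intro sum.cong refl arg_cong2[where f = "(*)"] prod.cong)
    (auto simp: poly_ring_def subset_iff)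

lemma poly_act_mult: "poly_act n g (a * b) = poly_act n g a * poly_act n g b"
  by (simp add: poly_act_def msubst_mult)

lemma poly_act_inverse:
  fixes g :: "'a::comm_ring_1 mat"
  assumes g: "g \<in> Units (ring_mat TYPE('a) n ())" and f: "f \<in> poly_ring n"
  shows "poly_act n (inv\<^bsub>ring_mat TYPE('a) n ()\<^esub> g) (poly_act n g f) = f"
proof -
  let ?R = "ring_mat TYPE('a) n ()"
  interpret R: ring ?R by (rule ring_mat)
  let ?h = "inv\<^bsub>?R\<^esub> g"
  have h: "?h \<in> carrier_mat n n" and g': "g \<in> carrier_mat n n"
    using R.Units_inv_closed[OF g] R.Units_closed[OF g] by (simp_all add: ring_mat_def)
  have hg: "?h * g = 1\<^sub>m n"
    using R.Units_l_inv[OF g] by (simp add: ring_mat_def)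
  have hh: "inv\<^bsub>?R\<^esub> ?h = g"
    using R.Units_inv_inv[OF g] .
  have "(\<Sum>k=1..n. mconst (?h $$ (j - 1, k - 1)) * (\<Sum>l=1..n. mconst (g $$ (k - 1, l - 1)) * mvar l))
      = mvar j" if j: "j \<in> {1..n}" for j
  proof -
    have entry: "(\<Sum>k=1..n. ?h $$ (j - 1, k - 1) * g $$ (k - 1, l - 1)) = (if l = j then 1 else 0)"
      if l: "l \<in> {1..n}" for l
    proof -
      have "(\<Sum>k=1..n. ?h $$ (j - 1, k - 1) * g $$ (k - 1, l - 1))
          = (\<Sum>k=0..<n. ?h $$ (j - 1, k) * g $$ (k, l - 1))"
        by (rule sum.reindex_bij_witness[of _ Suc "\<lambda>k. k - 1"]) auto
      also have "\<dots> = (?h * g) $$ (j - 1, l - 1)"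
        using h g' j l by (auto simp: scalar_prod_def)
      also have "\<dots> = (if l = j then 1 else 0)"
        using j l by (auto simp: hg)
      finally show ?thesis .
    qed
    have mconst_sum: "mconst (\<Sum>i\<in>I. c i) = (\<Sum>i\<in>I. mconst (c i))" for I :: "nat set" and c :: "nat \<Rightarrow> 'a"
      by (induction I rule: infinite_finite_induct) (simp_all add: mconst_hom)
    have "(\<Sum>k=1..n. mconst (?h $$ (j - 1, k - 1)) * (\<Sum>l=1..n. mconst (g $$ (k - 1, l - 1)) * mvar l))
        = (\<Sum>l=1..n. mconst (\<Sum>k=1..n. ?h $$ (j - 1, k - 1) * g $$ (k - 1, l - 1)) * mvar l)"
      unfolding mconst_sum sum_distrib_left sum_distrib_right mconst_hom
      by (subst sum.swap) (simp only: mult.assoc)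
    also have "\<dots> = (\<Sum>l=1..n. if l = j then mvar l else 0)"
      by (intro sum.cong refl, subst entry) (auto simp: mconst_hom)
    also have "\<dots> = mvar j" using j by simp
    finally show ?thesis .
  qed
  then show ?thesis
    unfolding poly_act_def hh msubst_comp
    by (subst msubst_cong[OF f, of _ mvar])
      (simp_all add: msubst_sum msubst_mult msubst_mconst msubst_mvar msubst_mvar_id)
qed

end

lemma fract_act_Fract:
  fixes g :: "'a::idom mat"
  assumes g: "g \<in> Units (ring_mat TYPE('a) n ())"
    and ab: "a \<in> poly_ring n" "b \<in> poly_ring n" "b \<noteq> 0"
  shows "fract_act n g (Fraction_Field.Fract a b)
    = Fraction_Field.Fract (poly_act n g a) (poly_act n g b)"
proof -
  have nz: "poly_act n g c \<noteq> 0" if "c \<in> poly_ring n" "c \<noteq> 0" for c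
    using poly_act_inverse[OF g that(1)] that(2) by (auto simp: poly_act_def msubst_def)
  show ?thesis
    unfolding fract_act_def
  proof (rule the_equality)
    fix s assume "\<exists>a'\<in>poly_ring n. \<exists>b'\<in>poly_ring n. b' \<noteq> 0 \<and>
      Fraction_Field.Fract a b = Fraction_Field.Fract a' b' \<and>
      s = Fraction_Field.Fract (poly_act n g a') (poly_act n g b')"
    then obtain a' b' where *: "a' \<in> poly_ring n" "b' \<in> poly_ring n" "b' \<noteq> 0"
      "Fraction_Field.Fract a b = Fraction_Field.Fract a' b'"
      "s = Fraction_Field.Fract (poly_act n g a') (poly_act n g b')" by blast
    then have "a * b' = a' * b" using ab by (simp add: eq_fract)
    then have "poly_act n g a * poly_act n g b' = poly_act n g a' * poly_act n g b"
      by (metis poly_act_mult)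
    then show "s = Fraction_Field.Fract (poly_act n g a) (poly_act n g b)"
      using * ab nz by (simp add: eq_fract)
  qed (use ab in blast)
qed

definition invariant_field :: "nat \<Rightarrow> 'a::idom mat set \<Rightarrow> 'a mpoly fract set" where
  "invariant_field n G = {r \<in> fun_field n. \<forall>g\<in>G. fract_act n g r = r}"

definition orbit_prod :: "nat \<Rightarrow> 'a::comm_ring_1 mat set \<Rightarrow> nat \<Rightarrow> 'a mpoly" where
  "orbit_prod n G j = \<Prod>((\<lambda>g. poly_act n g (mvar j)) ` G)"

definition field_adjoin :: "'a::idom mpoly set \<Rightarrow> 'a mpoly fract set" where
  "field_adjoin S = generate_field ring_of_type_algebra (to_fract ` (range mconst \<union> S))"

definition lower_unitriangular :: "nat \<Rightarrow> 'a::comm_ring_1 mat set" where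
  "lower_unitriangular n = {M \<in> carrier_mat n n.
      (\<forall>i<n. M $$ (i, i) = 1) \<and> (\<forall>i<n. \<forall>j<n. i < j \<longrightarrow> M $$ (i, j) = 0)}"

definition antidiag_mat :: "nat \<Rightarrow> 'a::comm_ring_1 mat" where
  "antidiag_mat n = mat n n (\<lambda>(i, j). if i + j = n - 1 then 1 else 0)"

definition unitary_unitriangular :: "nat \<Rightarrow> nat \<Rightarrow> 'a::comm_ring_1 mat set" where
  "unitary_unitriangular q n = {M \<in> lower_unitriangular n.
      transpose_mat M * antidiag_mat n * map_mat (\<lambda>c. c ^ q) M = antidiag_mat n}"

definition h_poly :: "nat \<Rightarrow> nat \<Rightarrow> nat \<Rightarrow> 'a::comm_ring_1 mpoly" where
  "h_poly q m k =
     (\<Sum>i=1..m. mvar (2 * m + 2 - i) ^ (q ^ (2 * k - 1)) * mvar i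
               + mvar (2 * m + 2 - i) * mvar i ^ (q ^ (2 * k - 1)))
     + mvar (m + 1) ^ (q ^ (2 * k - 1) + 1)"

end

theory Submission
  imports Defs "Jordan_Normal_Form.Determinant" "HOL-Number_Theory.Residues"
begin

text \<open>
  Let \<open>E\<^sub>r\<close> be the field generated by the proposed invariants together with \<open>x\<^sub>1, \<dots>, x\<^sub>r\<close>. An
  invariant function \<open>f\<close> lies in \<open>E\<^sub>n\<close>, and it descends from \<open>E\<^sub>r\<^sub>+\<^sub>1\<close> to \<open>E\<^sub>r\<close> provided
  \<open>x\<^sub>r\<^sub>+\<^sub>1\<close> is a root of a polynomial over \<open>E\<^sub>r\<close> whose degree is at most the size of the orbit of
  \<open>x\<^sub>r\<^sub>+\<^sub>1\<close> under the pointwise stabilizer of \<open>x\<^sub>1, \<dots>, x\<^sub>r\<close>. Let \<open>D\<^sub>l\<close> be the monic additive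
  polynomial whose roots are the linear combinations of \<open>x\<^sub>1, \<dots>, x\<^sub>l\<close>. For \<open>r \<le> m\<close> the polynomial
  \<open>D\<^sub>r(t) - N(x\<^sub>r\<^sub>+\<^sub>1)\<close> does the job. For \<open>r = n - 1 - l\<close> with \<open>l < m\<close> one uses
  \<open>a D\<^sub>l(t)\<^sup>q + a\<^sup>q D\<^sub>l(t) - b\<close> with \<open>a = D\<^sub>l(x\<^sub>l\<^sub>+\<^sub>1)\<close>: expanding \<open>D\<^sub>l\<close> in
  \<open>\<Sum>\<^sub>k D\<^sub>l(x\<^sub>k) D\<^sub>l(x\<^sub>n\<^sub>+\<^sub>1\<^sub>-\<^sub>k)\<^sup>q\<close> gives Frobenius powers of the \<open>h\<^sub>k\<close>, while
  \<open>D\<^sub>l\<close> kills \<open>x\<^sub>1, \<dots>, x\<^sub>l\<close>. The orbits are made large enough by explicit unitary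
  transvections.
\<close>

section \<open>Subfields and the descent step\<close>

text \<open>A predicate on subsets of a field type, so that type class arithmetic replaces carrier
  operations. The total \<open>inverse\<close> covers 0 too, and \<open>0 \<in> S\<close> follows
  from \<open>1 + (- 1)\<close>.\<close>

definition subfield_set :: "'k::field set \<Rightarrow> bool" where
  "subfield_set S \<longleftrightarrow> 1 \<in> S \<and> (\<forall>a\<in>S. \<forall>b\<in>S. a + b \<in> S \<and> a * b \<in> S)
     \<and> (\<forall>a\<in>S. - a \<in> S \<and> inverse a \<in> S)"

abbreviation field_gen :: "'k::field set \<Rightarrow> 'k set" where
  "field_gen S \<equiv> generate_field ring_of_type_algebra S"

lemma ring_of_type_algebra_ops [simp]:
  fixes a b :: "'k::field"
  shows "carrier (ring_of_type_algebra :: 'k ring) = UNIV"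
    and "a \<oplus>\<^bsub>ring_of_type_algebra\<^esub> b = a + b" and "a \<otimes>\<^bsub>ring_of_type_algebra\<^esub> b = a * b"
    and "\<one>\<^bsub>ring_of_type_algebra\<^esub> = (1 :: 'k)" and "\<zero>\<^bsub>ring_of_type_algebra\<^esub> = (0 :: 'k)"
    and "\<ominus>\<^bsub>ring_of_type_algebra\<^esub> a = - a"
    and "a \<noteq> 0 \<Longrightarrow> inv\<^bsub>ring_of_type_algebra\<^esub> a = inverse a"
proof -
  interpret K: field "ring_of_type_algebra :: 'k ring" by (rule field_from_type_algebra)
  show *: "carrier (ring_of_type_algebra :: 'k ring) = UNIV"
    "a \<oplus>\<^bsub>ring_of_type_algebra\<^esub> b = a + b" "a \<otimes>\<^bsub>ring_of_type_algebra\<^esub> b = a * b"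
    "\<one>\<^bsub>ring_of_type_algebra\<^esub> = (1 :: 'k)" "\<zero>\<^bsub>ring_of_type_algebra\<^esub> = (0 :: 'k)" for a b :: 'k
    by (simp_all add: ring_of_type_algebra_def)
  show "\<ominus>\<^bsub>ring_of_type_algebra\<^esub> a = - a"
    by (rule K.minus_equality) (simp_all add: *)
  show "inv\<^bsub>ring_of_type_algebra\<^esub> a = inverse a" if "a \<noteq> 0"
    by (rule K.comm_inv_char) (use that in \<open>simp_all add: *\<close>)
qed

lemma subfield_set_field_gen: "subfield_set (field_gen S)"
proof -
  have inv: "inverse a \<in> field_gen S" if "a \<in> field_gen S" for a
    using generate_field.m_inv[OF that] that by (cases "a = 0") auto
  show ?thesis
    unfolding subfield_set_def
    using generate_field.one[of ring_of_type_algebra S]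
      generate_field.eng_add[of _ ring_of_type_algebra S]
      generate_field.eng_mult[of _ ring_of_type_algebra S]
      generate_field.a_inv[of _ ring_of_type_algebra S] inv by auto
qed

lemma field_gen_superset: "S \<subseteq> field_gen S"
  by (auto intro: generate_field.incl)

lemma subfield_setD:
  assumes "subfield_set S"
  shows "0 \<in> S" "1 \<in> S" "a \<in> S \<Longrightarrow> b \<in> S \<Longrightarrow> a + b \<in> S" "a \<in> S \<Longrightarrow> b \<in> S \<Longrightarrow> a * b \<in> S"
    "a \<in> S \<Longrightarrow> - a \<in> S" "a \<in> S \<Longrightarrow> inverse a \<in> S" "a \<in> S \<Longrightarrow> b \<in> S \<Longrightarrow> a - b \<in> S"
    "a \<in> S \<Longrightarrow> b \<in> S \<Longrightarrow> a / b \<in> S"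
proof -
  show *: "1 \<in> S" "a \<in> S \<Longrightarrow> b \<in> S \<Longrightarrow> a + b \<in> S" "a \<in> S \<Longrightarrow> b \<in> S \<Longrightarrow> a * b \<in> S"
    "a \<in> S \<Longrightarrow> - a \<in> S" "a \<in> S \<Longrightarrow> inverse a \<in> S" for a b
    using assms by (auto simp: subfield_set_def)
  show "0 \<in> S" using *(2)[OF *(1) *(4)[OF *(1)]] by simp
  show "a - b \<in> S" if "a \<in> S" "b \<in> S" using *(2)[OF that(1) *(4)[OF that(2)]] by simp
  show "a / b \<in> S" if "a \<in> S" "b \<in> S"
    using *(3)[OF that(1) *(5)[OF that(2)]] by (simp add: field_simps)
qed

lemma subfield_set_power: "subfield_set S \<Longrightarrow> a \<in> S \<Longrightarrow> a ^ k \<in> S"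
  by (induction k) (auto intro: subfield_setD)

lemma subfield_set_sum: "subfield_set S \<Longrightarrow> (\<And>i. i \<in> I \<Longrightarrow> f i \<in> S) \<Longrightarrow> sum f I \<in> S"
  by (induction I rule: infinite_finite_induct) (auto intro: subfield_setD)

lemma subfield_set_prod: "subfield_set S \<Longrightarrow> (\<And>i. i \<in> I \<Longrightarrow> f i \<in> S) \<Longrightarrow> prod f I \<in> S"
  by (induction I rule: infinite_finite_induct) (auto intro: subfield_setD)

lemma field_gen_minimal:
  assumes K: "subfield_set K" and "S \<subseteq> K"
  shows "field_gen S \<subseteq> K"
proof
  fix x assume "x \<in> field_gen S"
  then show "x \<in> K"
    by (induction rule: generate_field.induct) (use assms in \<open>auto intro: subfield_setD\<close>)
qed

lemma field_gen_mono: "S \<subseteq> T \<Longrightarrow> field_gen S \<subseteq> field_gen T"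
  by (rule field_gen_minimal[OF subfield_set_field_gen]) (use field_gen_superset in blast)

section \<open>Polynomials with coefficients in a subfield\<close>

definition coeffs_in :: "'k::field set \<Rightarrow> 'k poly \<Rightarrow> bool" where
  "coeffs_in S P \<longleftrightarrow> (\<forall>i. coeff P i \<in> S)"

lemma coeffs_in_ops:
  assumes "subfield_set S"
  shows "coeffs_in S 0" "coeffs_in S 1"
    "coeffs_in S P \<Longrightarrow> coeffs_in S Q \<Longrightarrow> coeffs_in S (P + Q)"
    "coeffs_in S P \<Longrightarrow> coeffs_in S Q \<Longrightarrow> coeffs_in S (P - Q)"
    "coeffs_in S P \<Longrightarrow> coeffs_in S Q \<Longrightarrow> coeffs_in S (P * Q)"
    "coeffs_in S P \<Longrightarrow> coeffs_in S (- P)"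
    "c \<in> S \<Longrightarrow> coeffs_in S P \<Longrightarrow> coeffs_in S (smult c P)"
    "c \<in> S \<Longrightarrow> coeffs_in S P \<Longrightarrow> coeffs_in S (pCons c P)"
  using subfield_setD[OF assms] unfolding coeffs_in_def
  by (auto simp: coeff_mult coeff_pCons split: nat.split intro!: subfield_set_sum[OF assms])

lemma coeffs_in_power: "subfield_set S \<Longrightarrow> coeffs_in S P \<Longrightarrow> coeffs_in S (P ^ k)"
  by (induction k) (auto intro: coeffs_in_ops)

text \<open>The values \<open>A(x) / B(x)\<close> form a subfield containing \<open>x\<close> and
  \<open>S\<close>, hence they include the generated field.\<close>

lemma field_gen_insert_fraction:
  assumes S: "subfield_set S" and f: "f \<in> field_gen (insert x S)"
  obtains A B where "coeffs_in S A" "coeffs_in S B" "poly B x \<noteq> 0" "f = poly A x / poly B x"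
proof -
  define K where "K = {poly A x / poly B x | A B. coeffs_in S A \<and> coeffs_in S B \<and> poly B x \<noteq> 0}"
  note ops = coeffs_in_ops[OF S] and SD = subfield_setD[OF S]
  have K: "poly A x / poly B x \<in> K" if "coeffs_in S A" "coeffs_in S B" "poly B x \<noteq> 0" for A B
    using that by (auto simp: K_def)
  have S': "s \<in> K" if "s \<in> S" for s
    using K[of "[:s:]" 1] that by (simp add: ops SD)
  have "subfield_set K"
    unfolding subfield_set_def
  proof (intro conjI ballI)
    show "1 \<in> K" using S' SD by blast
  next
    fix a b assume "a \<in> K" "b \<in> K"
    then obtain A B A' B' where *: "coeffs_in S A" "coeffs_in S B" "poly B x \<noteq> 0"
      "a = poly A x / poly B x" "coeffs_in S A'" "coeffs_in S B'" "poly B' x \<noteq> 0"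
      "b = poly A' x / poly B' x" by (auto simp: K_def)
    have "a + b = poly (A * B' + A' * B) x / poly (B * B') x"
      "a * b = poly (A * A') x / poly (B * B') x"
      using *(3,7) unfolding *(4,8) by (simp_all add: add_frac_eq)
    moreover have "coeffs_in S (A * B' + A' * B)" "coeffs_in S (B * B')" "coeffs_in S (A * A')"
      "poly (B * B') x \<noteq> 0"
      using * by (auto intro: ops)
    ultimately show "a + b \<in> K" "a * b \<in> K"
      using K by metis+
  next
    fix a assume "a \<in> K"
    then obtain A B where *: "coeffs_in S A" "coeffs_in S B" "poly B x \<noteq> 0"
      "a = poly A x / poly B x" by (auto simp: K_def)
    show "- a \<in> K" using K[of "- A" B] * ops by simp
    show "inverse a \<in> K"
    proof (cases "poly A x = 0")
      case True
      then show ?thesis using * S' SD by auto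
    next
      case False
      then show ?thesis using K[of B A] * by simp
    qed
  qed
  moreover have "insert x S \<subseteq> K"
    using K[of "[:0, 1:]" 1] S' by (auto simp: ops SD)
  ultimately have "f \<in> K" using field_gen_minimal f by blast
  then show ?thesis using that by (auto simp: K_def)
qed

text \<open>Division with remainder by \<open>R\<close> in Horner order: once \<open>A\<close> is
  reduced, \<open>a + t A\<close> has degree at most \<open>degree R\<close>, so subtracting one
  multiple of \<open>R\<close> suffices and the coefficients stay in \<open>S\<close>.\<close>

lemma poly_reduce:
  assumes S: "subfield_set S" and R: "coeffs_in S R" "degree R > 0" and A: "coeffs_in S A"
  obtains A' where "coeffs_in S A'" "degree A' < degree R" "\<And>z. poly R z = 0 \<Longrightarrow> poly A' z = poly A z"
proof -
  note ops = coeffs_in_ops[OF S] and SD = subfield_setD[OF S]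
  have "\<exists>A'. coeffs_in S A' \<and> degree A' < degree R \<and> (\<forall>z. poly R z = 0 \<longrightarrow> poly A' z = poly A z)"
    using A
  proof (induction A)
    case 0
    then show ?case using R by (intro exI[of _ 0]) auto
  next
    case (pCons a A)
    have a: "a \<in> S" and "coeffs_in S A"
      using pCons.prems unfolding coeffs_in_def by (metis coeff_pCons_0, metis coeff_pCons_Suc)
    then obtain A' where A': "coeffs_in S A'" "degree A' < degree R"
      "\<And>z. poly R z = 0 \<Longrightarrow> poly A' z = poly A z" using pCons.IH by blast
    define P where "P = pCons a A'"
    define c where "c = coeff P (degree R) / lead_coeff R"
    have P: "coeffs_in S P" using a A' ops by (simp add: P_def)
    have c: "c \<in> S" using P R(1) SD by (auto simp: c_def coeffs_in_def)
    have "degree (P - smult c R) < degree R"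
    proof (rule degree_lessI)
      show "P - smult c R \<noteq> 0 \<or> degree R > 0" using R by simp
      have "degree P \<le> degree R"
        using A'(2) by (simp add: P_def degree_pCons_eq_if)
      then show "\<forall>k\<ge>degree R. coeff (P - smult c R) k = 0"
        using R(2) by (auto simp: c_def coeff_eq_0 le_less)
    qed
    moreover have "poly (P - smult c R) z = poly (pCons a A) z" if "poly R z = 0" for z
      using that A'(3)[OF that] by (simp add: P_def)
    ultimately show ?case
      using P c R by (intro exI[of _ "P - smult c R"]) (auto intro: ops)
  qed
  then show ?thesis using that by blast
qed

section \<open>Homomorphisms on a subfield and descent\<close>

text \<open>Relative to \<open>E\<close> because \<open>fract_act\<close> is controlled only on
  \<open>fun_field n\<close>. The zero map qualifies, so \<open>\<sigma> 1 = 1\<close> is a separate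
  condition; in \<open>descent\<close> it is implied by \<open>\<sigma>\<close> fixing
  \<open>S\<close>.\<close>

definition hom_on :: "'k::field set \<Rightarrow> ('k \<Rightarrow> 'k) \<Rightarrow> bool" where
  "hom_on E \<sigma> \<longleftrightarrow> (\<forall>a\<in>E. \<forall>b\<in>E. \<sigma> (a + b) = \<sigma> a + \<sigma> b \<and> \<sigma> (a * b) = \<sigma> a * \<sigma> b)"

lemma hom_onD:
  assumes E: "subfield_set E" and \<sigma>: "hom_on E \<sigma>" "\<sigma> 1 = 1"
  shows "\<sigma> 0 = 0"
    and "a \<in> E \<Longrightarrow> b \<in> E \<Longrightarrow> \<sigma> (a + b) = \<sigma> a + \<sigma> b"
    and "a \<in> E \<Longrightarrow> b \<in> E \<Longrightarrow> \<sigma> (a * b) = \<sigma> a * \<sigma> b"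
    and "a \<in> E \<Longrightarrow> \<sigma> (- a) = - \<sigma> a"
    and "a \<in> E \<Longrightarrow> b \<in> E \<Longrightarrow> \<sigma> (a - b) = \<sigma> a - \<sigma> b"
    and "a \<in> E \<Longrightarrow> \<sigma> (inverse a) = inverse (\<sigma> a)"
    and "a \<in> E \<Longrightarrow> \<sigma> (a ^ k) = \<sigma> a ^ k"
    and "(\<And>i. i \<in> I \<Longrightarrow> f i \<in> E) \<Longrightarrow> \<sigma> (sum f I) = (\<Sum>i\<in>I. \<sigma> (f i))"
proof -
  note ED = subfield_setD[OF E]
  show add: "\<sigma> (a + b) = \<sigma> a + \<sigma> b" and mult: "\<sigma> (a * b) = \<sigma> a * \<sigma> b" if "a \<in> E" "b \<in> E" for a b
    using \<sigma>(1) that by (auto simp: hom_on_def)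
  have "\<sigma> 0 + \<sigma> 0 = \<sigma> 0" using add[OF ED(1) ED(1)] by simp
  then show zero: "\<sigma> 0 = 0" by (metis add_cancel_right_right)
  show minus: "\<sigma> (- a) = - \<sigma> a" if "a \<in> E" for a
    using add[OF that ED(5)[OF that]] zero by (simp add: eq_neg_iff_add_eq_0 add.commute)
  show "\<sigma> (a - b) = \<sigma> a - \<sigma> b" if "a \<in> E" "b \<in> E"
    using add[OF that(1) ED(5)[OF that(2)]] minus[OF that(2)] by simp
  show "\<sigma> (inverse a) = inverse (\<sigma> a)" if "a \<in> E"
  proof (cases "a = 0")
    case False
    then have "\<sigma> a * \<sigma> (inverse a) = 1" using mult[OF that ED(6)[OF that]] \<sigma>(2) by simp
    then show ?thesis by (metis inverse_unique)
  qed (simp add: zero)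
  show "\<sigma> (a ^ k) = \<sigma> a ^ k" if "a \<in> E"
    by (induction k) (simp_all add: \<sigma>(2) mult that subfield_set_power[OF E])
  show "\<sigma> (sum f I) = (\<Sum>i\<in>I. \<sigma> (f i))" if "\<And>i. i \<in> I \<Longrightarrow> f i \<in> E"
    using that by (induction I rule: infinite_finite_induct) (simp_all add: zero add subfield_set_sum[OF E])
qed

lemma hom_on_fixed_subfield:
  assumes "subfield_set E" "hom_on E \<sigma>" "\<sigma> 1 = 1"
  shows "subfield_set {x \<in> E. \<sigma> x = x}"
  using subfield_setD[OF assms(1)] assms(3) hom_onD[OF assms] by (simp add: subfield_set_def)

lemma poly_closed:
  assumes "subfield_set E" "coeffs_in E P" "x \<in> E"
  shows "poly P x \<in> E"
  using assms subfield_setD[OF assms(1)]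
  by (auto simp: poly_altdef coeffs_in_def
      intro!: subfield_set_sum[OF assms(1)] subfield_set_power[OF assms(1)] subfield_setD(4)[OF assms(1)])

lemma hom_on_poly:
  assumes E: "subfield_set E" and \<sigma>: "hom_on E \<sigma>" and P: "coeffs_in E P" "\<And>i. \<sigma> (coeff P i) = coeff P i"
    and x: "x \<in> E"
  shows "\<sigma> (poly P x) = poly P (\<sigma> x)"
  using P
proof (induction P)
  case 0
  have "\<sigma> 0 = \<sigma> 0 + \<sigma> 0"
    using \<sigma> subfield_setD(1)[OF E] unfolding hom_on_def by (metis add_0)
  then have "\<sigma> 0 = 0" by (metis add_cancel_right_right)
  then show ?case by simp
next
  case (pCons a P)
  have a: "a \<in> E" "\<sigma> a = a" and P: "coeffs_in E P" "\<And>i. \<sigma> (coeff P i) = coeff P i"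
    using pCons.prems unfolding coeffs_in_def by (metis coeff_pCons_0, metis coeff_pCons_0, metis coeff_pCons_Suc, metis coeff_pCons_Suc)
  have "poly P x \<in> E" by (rule poly_closed[OF E P(1) x])
  then show ?case
    using \<sigma> a x pCons.IH[OF P] subfield_setD[OF E] by (simp add: hom_on_def)
qed

text \<open>
  The fraction \<open>f = A(x) / B(x)\<close> is reduced modulo \<open>R\<close>; then \<open>A - f B\<close> vanishes on the whole
  orbit of \<open>x\<close> and therefore identically, so \<open>f\<close> is a quotient of coefficients.
\<close>

lemma descent:
  assumes S: "subfield_set S" and E: "subfield_set E" "S \<subseteq> E" "x \<in> E"
    and R: "coeffs_in S R" "degree R > 0" "degree R \<le> card Z" "poly R x = 0"
    and f: "f \<in> field_gen (insert x S)"
    and hom: "\<And>z. z \<in> Z \<Longrightarrow> \<exists>\<sigma>. hom_on E \<sigma> \<and> (\<forall>s\<in>S. \<sigma> s = s) \<and> \<sigma> x = z \<and> \<sigma> f = f"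
  shows "f \<in> S"
proof -
  note SD = subfield_setD[OF S]
  obtain A0 B0 where 0: "coeffs_in S A0" "coeffs_in S B0" "poly B0 x \<noteq> 0" "f = poly A0 x / poly B0 x"
    using field_gen_insert_fraction[OF S f] .
  obtain A where A: "coeffs_in S A" "degree A < degree R" "\<And>z. poly R z = 0 \<Longrightarrow> poly A z = poly A0 z"
    using poly_reduce[OF S R(1,2) 0(1)] by metis
  obtain B where B: "coeffs_in S B" "degree B < degree R" "\<And>z. poly R z = 0 \<Longrightarrow> poly B z = poly B0 z"
    using poly_reduce[OF S R(1,2) 0(2)] by metis
  \<comment> \<open>Reduction preserves values at roots of \<open>R\<close>, and \<open>x\<close> is
    such a root, so the denominator stays nonzero.\<close>
  have Bx: "poly B x \<noteq> 0" and fAB: "f * poly B x = poly A x"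
    using 0 A(3)[OF R(4)] B(3)[OF R(4)] by auto
  have inE: "coeffs_in E P" if "coeffs_in S P" for P
    using that E(2) by (auto simp: coeffs_in_def)
  have fE: "f \<in> E"
    using 0 E poly_closed[OF E(1) inE E(3)] subfield_setD(8)[OF E(1)] by auto
  have root: "poly (A - smult f B) z = 0" if z: "z \<in> Z" for z
  proof -
    obtain \<sigma> where \<sigma>: "hom_on E \<sigma>" "\<forall>s\<in>S. \<sigma> s = s" "\<sigma> x = z" "\<sigma> f = f"
      using hom[OF z] by blast
    have "\<sigma> (poly P x) = poly P z" if "coeffs_in S P" for P
      using hom_on_poly[OF E(1) \<sigma>(1) inE[OF that] _ E(3)] that \<sigma> by (auto simp: coeffs_in_def)
    moreover have "\<sigma> (f * poly B x) = \<sigma> f * \<sigma> (poly B x)"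
      using \<sigma>(1) fE poly_closed[OF E(1) inE[OF B(1)] E(3)] by (auto simp: hom_on_def)
    ultimately show ?thesis
      using fAB A B \<sigma>(4) by simp
  qed
  have "A - smult f B = 0"
  proof (rule ccontr)
    assume nz: "A - smult f B \<noteq> 0"
    have "card Z \<le> card {z. poly (A - smult f B) z = 0}"
      by (rule card_mono) (use poly_roots_finite[OF nz] root in auto)
    also have "\<dots> \<le> degree (A - smult f B)" by (rule card_poly_roots_bound[OF nz])
    also have "\<dots> < degree R"
      using A(2) B(2) by (intro degree_diff_less) (auto intro: le_less_trans[OF degree_smult_le])
    finally show False using R(3) by simp
  qed
  then have *: "coeff A i = f * coeff B i" for i
    by (metis coeff_smult eq_iff_diff_eq_0)
  \<comment> \<open>Since \<open>A = f B\<close> holds coefficientwise, one nonzero coefficient of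
    \<open>B\<close> exhibits \<open>f\<close> as a quotient of elements of
    \<open>S\<close>.\<close>
  obtain i where "coeff B i \<noteq> 0" using Bx by (metis leading_coeff_0_iff poly_0)
  then have "f = coeff A i / coeff B i" using * by simp
  then show ?thesis using A(1) B(1) SD by (simp add: coeffs_in_def)
qed

section \<open>Frobenius maps\<close>

text \<open>Multiplication by a nonzero \<open>x\<close> permutes the nonzero elements; comparing
  their products gives the result.\<close>

lemma finite_field_power_card:
  fixes x :: "'a::{finite,field}"
  shows "x ^ card (UNIV :: 'a set) = x"
proof (cases "x = 0")
  case False
  let ?P = "\<Prod>y\<in>UNIV - {0::'a}. y"
  have "?P = (\<Prod>y\<in>UNIV - {0}. x * y)"
    by (rule prod.reindex_bij_witness[of _ "\<lambda>y. x * y" "\<lambda>y. y / x"]) (use False in auto)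
  also have "\<dots> = x ^ (card (UNIV :: 'a set) - 1) * ?P"
    by (simp add: prod.distrib card_Diff_singleton)
  finally have "x ^ (card (UNIV :: 'a set) - 1) = 1" by simp
  moreover have "card (UNIV :: 'a set) = Suc (card (UNIV :: 'a set) - 1)"
    by (simp add: card_gt_0_iff)
  ultimately show ?thesis by (metis mult.right_neutral power_Suc)
qed (simp add: card_gt_0_iff)

lemma CHAR_of_card:
  assumes "prime p" and "card (UNIV :: 'a::{finite,field} set) = p ^ k"
  shows "CHAR('a) = p"
proof -
  have "CHAR('a) > 0" by (rule finite_imp_CHAR_pos) simp
  then have "prime CHAR('a)" by (rule prime_CHAR_semidom)
  moreover have "CHAR('a) dvd p ^ k" using CHAR_dvd_CARD[where 'a = 'a] assms(2) by simp
  ultimately show ?thesis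
    using assms(1) by (metis prime_dvd_power primes_dvd_imp_eq)
qed

lemma frobenius_add:
  fixes x y :: "'k::field"
  assumes "prime CHAR('k)"
  shows "(x + y) ^ (CHAR('k) ^ k) = x ^ (CHAR('k) ^ k) + y ^ (CHAR('k) ^ k)"
  by (rule freshmans_dream'[OF assms refl])

lemma frobenius_minus:
  fixes x :: "'k::field"
  assumes "prime CHAR('k)"
  shows "(- x) ^ (CHAR('k) ^ k) = - (x ^ (CHAR('k) ^ k))"
  using frobenius_add[OF assms, of x "- x" k] assms
  by (simp add: power_0_left prime_gt_0_nat eq_neg_iff_add_eq_0 add.commute)

section \<open>Unitary lower unitriangular matrices\<close>

text \<open>Entrywise form of \<open>J * transpose (map_mat (\<lambda>c. c ^ q) g) * J\<close>, the
  adjoint for the Hermitian form with matrix \<open>J = antidiag_mat n\<close>. It is the inverse of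
  a unitary \<open>g\<close>.\<close>

definition hstar :: "nat \<Rightarrow> nat \<Rightarrow> 'a::comm_ring_1 mat \<Rightarrow> 'a mat" where
  "hstar q n g = mat n n (\<lambda>(i, j). g $$ (n - 1 - j, n - 1 - i) ^ q)"

lemma hstar_carrier [simp]: "hstar q n g \<in> carrier_mat n n"
  by (simp add: hstar_def)

text \<open>Right multiplication by the antidiagonal matrix reverses the columns, which leaves a
  single sum.\<close>

lemma hermitian_gram_entry:
  fixes g :: "'a::comm_ring_1 mat"
  assumes g: "g \<in> carrier_mat n n" and ij: "i < n" "j < n"
  shows "(transpose_mat g * antidiag_mat n * map_mat (\<lambda>c. c ^ q) g) $$ (i, j)
    = (\<Sum>k<n. g $$ (k, i) * g $$ (n - 1 - k, j) ^ q)"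
proof -
  have J: "(transpose_mat g * antidiag_mat n) $$ (i, l) = g $$ (n - 1 - l, i)" if l: "l < n" for l
  proof -
    have "(transpose_mat g * antidiag_mat n) $$ (i, l)
        = (\<Sum>k\<in>{0..<n}. g $$ (k, i) * (if k + l = n - 1 then 1 else 0))"
      using g ij l by (simp add: antidiag_mat_def scalar_prod_def)
    also have "\<dots> = (\<Sum>k\<in>{0..<n}. if k = n - 1 - l then g $$ (k, i) else 0)"
      using l by (intro sum.cong refl) auto
    finally have "(transpose_mat g * antidiag_mat n) $$ (i, l)
        = (\<Sum>k\<in>{0..<n}. if k = n - 1 - l then g $$ (k, i) else 0)" .
    then show ?thesis using l by simp
  qed
  have c: "transpose_mat g * antidiag_mat n \<in> carrier_mat n n"
    using g by (simp add: antidiag_mat_def)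
  have "(transpose_mat g * antidiag_mat n * map_mat (\<lambda>c. c ^ q) g) $$ (i, j)
      = (\<Sum>l\<in>{0..<n}. (transpose_mat g * antidiag_mat n) $$ (i, l) * g $$ (l, j) ^ q)"
    using g c ij by (subst index_mult_mat(1)) (auto simp: scalar_prod_def)
  also have "\<dots> = (\<Sum>l\<in>{0..<n}. g $$ (n - 1 - l, i) * g $$ (l, j) ^ q)"
    by (intro sum.cong refl) (simp add: J)
  also have "\<dots> = (\<Sum>k<n. g $$ (k, i) * g $$ (n - 1 - k, j) ^ q)"
    by (rule sum.reindex_bij_witness[of _ "\<lambda>k. n - 1 - k" "\<lambda>k. n - 1 - k"]) auto
  finally show ?thesis .
qed

text \<open>Both matrix equations unfold to the same scalar identities, up to reversing one index.
  This allows passing between the defining equation and a left inverse.\<close>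

lemma unitary_iff_hstar:
  fixes g :: "'a::comm_ring_1 mat"
  assumes g: "g \<in> carrier_mat n n"
  shows "transpose_mat g * antidiag_mat n * map_mat (\<lambda>c. c ^ q) g = antidiag_mat n
    \<longleftrightarrow> (\<forall>i<n. \<forall>j<n. (\<Sum>k<n. g $$ (k, i) * g $$ (n - 1 - k, j) ^ q) = of_bool (i + j = n - 1))"
    and "hstar q n g * g = 1\<^sub>m n
    \<longleftrightarrow> (\<forall>i<n. \<forall>j<n. (\<Sum>k<n. g $$ (k, i) * g $$ (n - 1 - k, j) ^ q) = of_bool (i + j = n - 1))"
    (is "_ \<longleftrightarrow> ?R")
proof -
  show "transpose_mat g * antidiag_mat n * map_mat (\<lambda>c. c ^ q) g = antidiag_mat n \<longleftrightarrow> ?R"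
  proof -
    define A where "A = transpose_mat g * antidiag_mat n * map_mat (\<lambda>c. c ^ q) g"
    have "A \<in> carrier_mat n n"
      unfolding A_def antidiag_mat_def by (intro mult_carrier_mat[of _ n n]) (use g in auto)
    then have "A = antidiag_mat n \<longleftrightarrow> (\<forall>i<n. \<forall>j<n. A $$ (i, j) = of_bool (i + j = n - 1))"
      by (subst mat_eq_iff) (auto simp: antidiag_mat_def)
    also have "\<dots> \<longleftrightarrow> ?R"
      unfolding A_def by (simp only: hermitian_gram_entry[OF g] cong: all_cong)
    finally show ?thesis unfolding A_def .
  qed
  have entry: "(hstar q n g * g) $$ (a, i) = (\<Sum>k<n. g $$ (k, i) * g $$ (n - 1 - k, n - 1 - a) ^ q)"
    if "a < n" "i < n" for a i
    using that g by (auto simp: hstar_def scalar_prod_def mult.commute lessThan_atLeast0 intro!: sum.cong)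
  show "hstar q n g * g = 1\<^sub>m n \<longleftrightarrow> ?R"
  proof
    assume *: "hstar q n g * g = 1\<^sub>m n"
    show ?R
    proof (intro allI impI)
      fix i j assume ij: "i < n" "j < n"
      then have "n - 1 - (n - 1 - j) = j" "1\<^sub>m n $$ (n - 1 - j, i) = (of_bool (i + j = n - 1) :: 'a)"
        by auto
      then show "(\<Sum>k<n. g $$ (k, i) * g $$ (n - 1 - k, j) ^ q) = of_bool (i + j = n - 1)"
        using entry[of "n - 1 - j" i] ij by (simp only: *)
    qed
  next
    assume R: ?R
    show "hstar q n g * g = 1\<^sub>m n"
    proof (rule eq_matI)
      fix a i assume "a < dim_row (1\<^sub>m n :: 'a mat)" "i < dim_col (1\<^sub>m n :: 'a mat)"
      then have ai: "a < n" "i < n" by auto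
      then have "(hstar q n g * g) $$ (a, i) = of_bool (i + (n - 1 - a) = n - 1)"
        using R by (simp add: entry del: index_mult_mat(1))
      then show "(hstar q n g * g) $$ (a, i) = 1\<^sub>m n $$ (a, i)" using ai by auto
    qed (use g in \<open>auto simp: hstar_def\<close>)
  qed
qed

text \<open>A left inverse of a square matrix is two-sided, and \<open>hstar\<close> is an
  involution because \<open>c \<mapsto> c ^ q\<close> is one. So \<open>g * hstar q n g = 1\<close>
  is the left inverse equation for \<open>hstar q n g\<close>, which makes the inverse unitary as
  well.\<close>

lemma unitary_hstar:
  fixes g :: "'a::field mat"
  assumes q: "\<And>c::'a. (c ^ q) ^ q = c" and g: "g \<in> unitary_unitriangular q n"
  shows "hstar q n g \<in> unitary_unitriangular q n" "hstar q n (hstar q n g) = g"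
    "g \<in> Units (ring_mat TYPE('a) n ())" "inv\<^bsub>ring_mat TYPE('a) n ()\<^esub> g = hstar q n g"
proof -
  have gc: "g \<in> carrier_mat n n" and diag: "\<And>i. i < n \<Longrightarrow> g $$ (i, i) = 1"
    and low: "\<And>i j. i < n \<Longrightarrow> j < n \<Longrightarrow> i < j \<Longrightarrow> g $$ (i, j) = 0"
    and un: "transpose_mat g * antidiag_mat n * map_mat (\<lambda>c. c ^ q) g = antidiag_mat n"
    using g by (auto simp: unitary_unitriangular_def lower_unitriangular_def)
  have q0: "q > 0" using q[of 0] q[of 1] by (cases q) auto
  have l: "hstar q n g * g = 1\<^sub>m n"
    using un unitary_iff_hstar[OF gc, of q] by blast
  have r: "g * hstar q n g = 1\<^sub>m n"
    by (rule mat_mult_left_right_inverse[OF hstar_carrier gc l])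
  show hh: "hstar q n (hstar q n g) = g"
    using gc by (intro eq_matI) (auto simp: hstar_def q)
  have "hstar q n (hstar q n g) * hstar q n g = 1\<^sub>m n"
    by (simp only: hh r)
  then have "transpose_mat (hstar q n g) * antidiag_mat n * map_mat (\<lambda>c. c ^ q) (hstar q n g) = antidiag_mat n"
    using unitary_iff_hstar[where g = "hstar q n g" and n = n and q = q] by simp
  then show "hstar q n g \<in> unitary_unitriangular q n"
    using diag low q0 by (auto simp: unitary_unitriangular_def lower_unitriangular_def)
      (auto simp: hstar_def power_0_left)
  interpret R: ring "ring_mat TYPE('a) n ()" by (rule ring_mat)
  show "g \<in> Units (ring_mat TYPE('a) n ())"
    using l r gc by (auto simp: Units_def ring_mat_def intro!: bexI[of _ "hstar q n g"])
  show "inv\<^bsub>ring_mat TYPE('a) n ()\<^esub> g = hstar q n g"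
    by (rule R.inv_unique'[symmetric]) (use l r gc in \<open>auto simp: ring_mat_def\<close>)
qed

text \<open>The Gram sum of two columns of an identity matrix modified by two rank one terms, as
  needed for \<open>transvection_unitary\<close>.\<close>

lemma sum_rank_one_product:
  fixes w u :: "nat \<Rightarrow> 'a::comm_ring_1"
  assumes "finite A" "i \<in> A" "r \<in> A" "j \<in> A" "s \<in> A"
  shows "(\<Sum>k\<in>A. (of_bool (k = i) + g * of_bool (k = r) + v * w k)
      * (of_bool (k = j) + g' * of_bool (k = s) + v' * u k))
    = of_bool (i = j) + g' * of_bool (i = s) + v' * u i + g * of_bool (r = j) + g * g' * of_bool (r = s)
      + g * v' * u r + v * w j + v * g' * w s + v * v' * (\<Sum>k\<in>A. w k * u k)"
proof -
  have *: "(\<Sum>k\<in>A. of_bool (k = i) * f k) = f i" if "i \<in> A" for i and f :: "nat \<Rightarrow> 'a"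
    using assms(1) that by (simp add: of_bool_def if_distrib[of "\<lambda>x. x * _"] cong: if_cong)
  have "(\<Sum>k\<in>A. (of_bool (k = i) + g * of_bool (k = r) + v * w k)
      * (of_bool (k = j) + g' * of_bool (k = s) + v' * u k))
    = (\<Sum>k\<in>A. of_bool (k = i) * (of_bool (k = j) + g' * of_bool (k = s) + v' * u k))
      + g * (\<Sum>k\<in>A. of_bool (k = r) * (of_bool (k = j) + g' * of_bool (k = s) + v' * u k))
      + v * ((\<Sum>k\<in>A. of_bool (k = j) * w k) + g' * (\<Sum>k\<in>A. of_bool (k = s) * w k)
        + v' * (\<Sum>k\<in>A. w k * u k))"
    unfolding sum_distrib_left sum.distrib[symmetric]
    by (intro sum.cong refl) (simp only: algebra_simps)
  also have "\<dots> = of_bool (i = j) + g' * of_bool (i = s) + v' * u i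
      + g * (of_bool (r = j) + g' * of_bool (r = s) + v' * u r)
      + v * (w j + g' * w s + v' * (\<Sum>k\<in>A. w k * u k))"
    using assms(2-) by (simp only: *)
  finally show ?thesis by (simp add: algebra_simps)
qed

text \<open>
  The matrix of the unitary transformation
  \<open>x \<mapsto> x + \<langle>x, w\<rangle> e\<^sub>r - \<langle>x, e\<^sub>r\<rangle> w + \<mu> \<langle>x, w\<rangle> w + c \<langle>x, e\<^sub>r\<rangle> e\<^sub>r\<close> for an isotropic vector \<open>w\<close>
  orthogonal to \<open>e\<^sub>r\<close>.
\<close>

lemma transvection_unitary:
  fixes a :: "nat \<Rightarrow> 'a::field" and c \<mu> :: 'a
  assumes char: "prime CHAR('a)" "q = CHAR('a) ^ e" and power_q_q: "\<And>c::'a. (c ^ q) ^ q = c"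
    and r: "r < n" "s = n - 1 - r"
    and c: "c ^ q + c = 0" "c \<noteq> 0 \<Longrightarrow> s < r" and \<mu>: "\<mu> ^ q + \<mu> = - of_bool (r = s)"
    and a: "\<And>k. a k \<noteq> 0 \<Longrightarrow> k < min r s"
  defines "h \<equiv> mat n n (\<lambda>(k, i). of_bool (k = i) + (a i + c * of_bool (i = s)) * of_bool (k = r)
      + (\<mu> * a i - of_bool (i = s)) * a (n - 1 - k) ^ q)"
  shows "h \<in> unitary_unitriangular q n"
    and "\<And>k i. k < r \<Longrightarrow> i < n \<Longrightarrow> h $$ (k, i) = of_bool (k = i)"
    and "\<And>i. i < n \<Longrightarrow> h $$ (r, i) = of_bool (r = i) + a i + c * of_bool (i = s)"
proof -
  define \<gamma> where "\<gamma> i = a i + c * of_bool (i = s)" for i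
  define \<nu> where "\<nu> i = \<mu> * a i - of_bool (i = s)" for i
  define w where "w k = a (n - 1 - k) ^ q" for k
  \<comment> \<open>So \<open>h\<close> is the identity plus the rank one terms formed from
    \<open>e_r\<close>, \<open>\<gamma>\<close> and from \<open>w\<close>,
    \<open>\<nu>\<close>.\<close>
  have h: "h $$ (k, i) = of_bool (k = i) + \<gamma> i * of_bool (k = r) + \<nu> i * w k" if "k < n" "i < n" for k i
    using that by (simp add: h_def \<gamma>_def \<nu>_def w_def)
  have q0: "q > 0" using char by (simp add: prime_gt_0_nat)
  \<comment> \<open>The reversal \<open>k \<mapsto> n - 1 - k\<close> swaps \<open>r\<close> and
    \<open>s\<close>, so it carries the support of \<open>a\<close>, below \<open>min r s\<close>,
    to indices above \<open>max r s\<close>. Hence \<open>w\<close> is isotropic and vanishes at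
    \<open>r\<close> and \<open>s\<close>.\<close>
  have w: "w k \<noteq> 0 \<Longrightarrow> k > max r s" if "k < n" for k
    using a[of "n - 1 - k"] that r q0 by (auto simp: w_def power_0_left split: if_splits)
  have ar: "a r = 0" "a s = 0" using a[of r] a[of s] by auto
  have wrs: "w r = 0" "w s = 0" using w[of r] w[of s] r by auto
  have frob: "(x + y) ^ q = x ^ q + y ^ q" "(- x) ^ q = - (x ^ q)" "(x - y) ^ q = x ^ q - y ^ q"
    "of_bool b ^ q = (of_bool b :: 'a)" for x y :: 'a and b
    using frobenius_add[OF char(1), of x y e] frobenius_add[OF char(1), of x "- y" e]
      frobenius_minus[OF char(1), of _ e] q0 by (auto simp: char(2))
  \<comment> \<open>A nonzero \<open>\<nu> i\<close> forces \<open>i \<le> s\<close>, a nonzero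
    \<open>w k\<close> forces \<open>k > s\<close>: this term lies strictly below the
    diagonal.\<close>
  have low: "\<nu> i * w k = 0" if "k \<le> i" "k < n" "i < n" for k i
    using w[of k] a[of i] that by (cases "a i = 0"; cases "w k = 0") (auto simp: \<nu>_def)
  show row1: "h $$ (k, i) = of_bool (k = i)" if "k < r" "i < n" for k i
    using that r w[of k] by (auto simp: h)
  show row2: "h $$ (r, i) = of_bool (r = i) + a i + c * of_bool (i = s)" if "i < n" for i
    using that r wrs by (simp add: h \<gamma>_def)
  have hc: "h \<in> carrier_mat n n" by (simp add: h_def)
  have \<gamma>0: "\<gamma> i = 0" if "r \<le> i" for i
    using a[of i] c(2) that by (cases "a i = 0"; cases "c = 0") (auto simp: \<gamma>_def)
  have "h $$ (i, i) = 1" if "i < n" for i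
    using that low[of i i] \<gamma>0[of i] by (auto simp: h)
  moreover have "h $$ (k, i) = 0" if "k < n" "i < n" "k < i" for k i
    using that low[of k i] \<gamma>0[of i] by (auto simp: h)
  ultimately have tri: "h \<in> lower_unitriangular n"
    using hc by (simp add: lower_unitriangular_def)
  have "(\<Sum>k<n. h $$ (k, i) * h $$ (n - 1 - k, j) ^ q) = of_bool (i + j = n - 1)"
    if ij: "i < n" "j < n" for i j
  proof -
    have w_star: "w (n - 1 - k) ^ q = a k" if "k < n" for k
      using that by (simp add: w_def power_q_q)
    have "s < n" using r by simp
    have wa: "(\<Sum>k<n. w k * a k) = 0"
      using w a by (intro sum.neutral) fastforce
    have "(\<Sum>k<n. h $$ (k, i) * h $$ (n - 1 - k, j) ^ q)
      = (\<Sum>k<n. (of_bool (k = i) + \<gamma> i * of_bool (k = r) + \<nu> i * w k)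
        * (of_bool (k = n - 1 - j) + \<gamma> j ^ q * of_bool (k = s) + \<nu> j ^ q * a k))"
    proof (intro sum.cong refl)
      fix k assume "k \<in> {..<n}"
      then have k: "k < n" by simp
      have "(n - 1 - k = j) = (k = n - 1 - j)" "(n - 1 - k = r) = (k = s)"
        using k ij r by auto
      then show "h $$ (k, i) * h $$ (n - 1 - k, j) ^ q
        = (of_bool (k = i) + \<gamma> i * of_bool (k = r) + \<nu> i * w k)
        * (of_bool (k = n - 1 - j) + \<gamma> j ^ q * of_bool (k = s) + \<nu> j ^ q * a k)"
        using k ij w_star[OF k] by (simp add: h frob power_mult_distrib)
    qed
    also have "\<dots> = of_bool (i = n - 1 - j) + \<gamma> j ^ q * of_bool (i = s) + \<nu> j ^ q * a i
      + \<gamma> i * of_bool (r = n - 1 - j) + \<gamma> i * \<gamma> j ^ q * of_bool (r = s) + \<nu> i * w (n - 1 - j)"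
      using ij r(1) \<open>s < n\<close> by (subst sum_rank_one_product) (auto simp: wa wrs ar)
    \<comment> \<open>The mixed terms in \<open>a\<close> and \<open>of_bool (_ = s)\<close> cancel.
      The trace expressions that remain vanish by the choice of \<open>\<mu>\<close> and
      \<open>c\<close>; for \<open>r = s\<close> the value of \<open>c\<close> is 0, so
      \<open>\<gamma>\<close> is just \<open>a\<close>.\<close>
    also have "\<dots> = of_bool (i = n - 1 - j) + (\<mu> ^ q + \<mu> + of_bool (r = s)) * (a i * a j ^ q)
      + (c ^ q + c) * of_bool (i = s \<and> j = s)"
    proof -
      have "(r = n - 1 - j) = (j = s)" "w (n - 1 - j) = a j ^ q" "r = s \<Longrightarrow> c = 0"
        using ij r c(2) by (auto simp: w_def)
      then show ?thesis
        using q0 by (auto simp: \<gamma>_def \<nu>_def frob power_mult_distrib algebra_simps ar power_0_left)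
    qed
    also have "\<dots> = of_bool (i + j = n - 1)"
      using ij c \<mu> by auto
    finally show ?thesis .
  qed
  then show "h \<in> unitary_unitriangular q n"
    using tri unitary_iff_hstar(1)[OF hc, of q] by (simp add: unitary_unitriangular_def)
qed

section \<open>Elimination in an abstract function field\<close>

text \<open>Elimination needs only a field containing the constants (via \<open>\<kappa>\<close>)
  and elements \<open>\<xi> i\<close> that are linearly independent over them. The rational
  functions are one instance.\<close>

locale hermitian_field =
  fixes p e q m n :: nat and \<kappa> :: "'a::{finite,field} \<Rightarrow> 'k::field" and \<xi> :: "nat \<Rightarrow> 'k"
  assumes p: "prime p" and e: "e \<ge> 1" and q: "q = p ^ e"
    and card_a: "card (UNIV :: 'a set) = q ^ 2" and n: "n = 2 * m + 1"
    and \<kappa>_add: "\<kappa> (a + b) = \<kappa> a + \<kappa> b" and \<kappa>_mult: "\<kappa> (a * b) = \<kappa> a * \<kappa> b"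
    and \<kappa>_1: "\<kappa> 1 = 1"
    and indep: "(\<Sum>i=1..n. \<kappa> (c i) * \<xi> i) = 0 \<Longrightarrow> i \<in> {1..n} \<Longrightarrow> c i = 0"
begin

lemma q_ge_2: "q \<ge> 2"
proof -
  have "2 \<le> p" using p by (rule prime_ge_2_nat)
  also have "\<dots> \<le> p ^ e" using e prime_gt_0_nat[OF p] by (simp add: self_le_power)
  finally show ?thesis by (simp add: q)
qed

lemma CHAR_a: "CHAR('a) = p"
  by (rule CHAR_of_card[OF p, where k = "e * 2"]) (simp add: card_a q power_mult)

lemma power_q_q: "(c ^ q) ^ q = (c :: 'a)"
  using finite_field_power_card[of c] by (simp add: card_a power2_eq_square power_mult)

lemma \<kappa>_0: "\<kappa> 0 = 0"
  using \<kappa>_add[of 0 0] by (metis add.right_neutral add_cancel_right_right)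

lemma \<kappa>_minus: "\<kappa> (- c) = - \<kappa> c"
  using \<kappa>_add[of c "- c"] by (simp add: \<kappa>_0 eq_neg_iff_add_eq_0 add.commute)

lemma \<kappa>_diff: "\<kappa> (a - b) = \<kappa> a - \<kappa> b"
  using \<kappa>_add[of a "- b"] by (simp add: \<kappa>_minus)

lemma \<kappa>_power: "\<kappa> (c ^ k) = \<kappa> c ^ k"
  by (induction k) (simp_all add: \<kappa>_1 \<kappa>_mult)

lemma CHAR_k: "CHAR('k) = p"
proof -
  have "\<kappa> (of_nat i) = of_nat i" for i
    by (induction i) (simp_all add: \<kappa>_0 \<kappa>_1 \<kappa>_add)
  then have "of_nat p = (0 :: 'k)"
    using CHAR_a by (metis \<kappa>_0 of_nat_CHAR)
  then have "CHAR('k) dvd p" by (simp add: of_nat_eq_0_iff_char_dvd)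
  then show ?thesis using p by (auto simp: prime_nat_iff)
qed

lemma frob_add: "(x + y :: 'k) ^ (q ^ j) = x ^ (q ^ j) + y ^ (q ^ j)"
  using frobenius_add[of x y "e * j"] p by (simp add: CHAR_k q power_mult)

lemma frob_sum: "(\<Sum>i\<in>I. f i :: 'k) ^ (q ^ j) = (\<Sum>i\<in>I. f i ^ (q ^ j))"
  by (rule freshmans_dream_sum'[where n = "e * j"]) (use p in \<open>simp_all add: CHAR_k q power_mult\<close>)

lemma frob_add_a: "(x + y :: 'a) ^ q = x ^ q + y ^ q"
  using frobenius_add[of x y e] p by (simp add: CHAR_a q)

lemma frob_minus_a: "(- x :: 'a) ^ q = - (x ^ q)"
  using frobenius_minus[of x e] p by (simp add: CHAR_a q)

section \<open>The trace map of the constant field\<close>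

text \<open>Used with \<open>b = 1\<close> for the kernel of the trace and with
  \<open>b = - 1\<close> for the elements fixed by Frobenius.\<close>

lemma card_roots_frobenius:
  fixes b c :: 'a
  shows "card {x::'a. x ^ q + b * x + c = 0} \<le> q"
proof -
  define P where "P = monom 1 q + [:c, b:]"
  have "degree P = q"
    unfolding P_def using q_ge_2
    by (subst degree_add_eq_left) (auto simp: degree_monom_eq intro: le_less_trans[OF degree_pCons_le])
  moreover from this have "P \<noteq> 0" using q_ge_2 by auto
  moreover have "{x. x ^ q + b * x + c = 0} = {x. poly P x = 0}"
    by (auto simp: P_def poly_monom algebra_simps)
  ultimately show ?thesis using card_poly_roots_bound[of P] by simp
qed

text \<open>The trace \<open>c \<mapsto> c\<^sup>q + c\<close> takes at most \<open>q\<close> values, all of them fixed by Frobenius.\<close>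

lemma card_trace_kernel: "card {c::'a. c ^ q + c = 0} \<ge> q"
proof -
  define tr where "tr c = c ^ q + c" for c :: 'a
  have tr: "tr (x - y) = tr x - tr y" for x y
    using frob_add_a[of x "- y"] by (simp add: tr_def frob_minus_a)
  have "range tr \<subseteq> {x. x ^ q + (- 1) * x + 0 = 0}"
    by (auto simp: tr_def frob_add_a power_q_q)
  then have R: "card (range tr) \<le> q"
    using card_mono[OF finite, of "range tr" "{x. x ^ q + (- 1) * x + 0 = 0}"] card_roots_frobenius[of "- 1" 0] by linarith
  \<comment> \<open>A nonempty fibre is a translate of a subset of the kernel. With
    \<open>q * q\<close> elements in at most \<open>q\<close> fibres, the kernel must have at least
    \<open>q\<close> elements.\<close>
  have fiber: "card (tr -` {s}) \<le> card {c. tr c = 0}" if "s \<in> range tr" for s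
  proof -
    obtain b where b: "s = tr b" using \<open>s \<in> range tr\<close> by blast
    show ?thesis
      by (rule card_inj_on_le[of "\<lambda>x. x - b"]) (auto simp: inj_on_def tr b)
  qed
  have "(\<Union>s\<in>range tr. tr -` {s}) = UNIV" by auto
  then have "q * q = card (\<Union>s\<in>range tr. tr -` {s})"
    using card_a by (simp add: power2_eq_square)
  also have "\<dots> \<le> (\<Sum>s\<in>range tr. card (tr -` {s}))"
    by (rule card_UN_le) simp
  also have "\<dots> \<le> card (range tr) * card {c. tr c = 0}"
    using sum_bounded_above[of "range tr" "\<lambda>s. card (tr -` {s})", OF fiber] by simp
  also have "\<dots> \<le> q * card {c. tr c = 0}"
    using R by (rule mult_right_mono) simp
  finally show ?thesis using q_ge_2 by (simp add: tr_def)
qed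

text \<open>The kernel of the trace has at most \<open>q < q ^ 2\<close> elements, so some trace
  \<open>s\<close> is nonzero. As \<open>s ^ q = s\<close>, scaling by \<open>- 1 / s\<close>
  commutes with the trace.\<close>

lemma trace_minus_1: "\<exists>\<mu>::'a. \<mu> ^ q + \<mu> = - 1"
proof -
  have "card {c::'a. c ^ q + c = 0} \<le> q" using card_roots_frobenius[of 1 0] by simp
  also have "q < q ^ 2" using q_ge_2 by (simp add: power2_eq_square)
  also have "\<dots> = card (UNIV :: 'a set)" by (simp add: card_a)
  finally have "{c::'a. c ^ q + c = 0} \<noteq> UNIV" by auto
  then obtain b :: 'a where b: "b ^ q + b \<noteq> 0" by auto
  define s where "s = b ^ q + b"
  have "s ^ q = s" by (simp add: s_def frob_add_a power_q_q)
  then have "(- (b / s)) ^ q + (- (b / s)) = - ((b ^ q + b) / s)"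
    by (simp only: frob_minus_a power_divide) (simp add: add_divide_distrib)
  also have "\<dots> = - 1" using b by (simp add: s_def)
  finally show ?thesis by blast
qed

section \<open>Additive polynomials with prescribed roots\<close>

text \<open>This is the polynomial \<open>D_l\<close>. The recursion makes additivity and the
  coefficients accessible; the product over its roots is derived in
  \<open>span_poly_prod\<close>.\<close>

primrec span_poly :: "nat \<Rightarrow> 'k poly" where
  "span_poly 0 = [:0, 1:]"
| "span_poly (Suc l) = span_poly l ^ (q ^ 2)
    - smult (poly (span_poly l) (\<xi> (Suc l)) ^ (q ^ 2 - 1)) (span_poly l)"

definition span_vars :: "nat \<Rightarrow> 'k set" where
  "span_vars l = range (\<lambda>c. \<Sum>i=1..l. \<kappa> (c i) * \<xi> i)"

lemma span_poly_add: "poly (span_poly l) (x + y) = poly (span_poly l) x + poly (span_poly l) y"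
  by (induction l) (simp_all add: frob_add[where j = 2] algebra_simps)

lemma span_poly_0: "poly (span_poly l) 0 = 0"
  using span_poly_add[of l 0 0] by (metis add.right_neutral add_cancel_right_right)

lemma span_poly_scale: "poly (span_poly l) (\<kappa> c * x) = \<kappa> c * poly (span_poly l) x"
proof (induction l)
  case (Suc l)
  have "\<kappa> c ^ (q ^ 2) = \<kappa> c"
    by (simp add: power2_eq_square power_mult power_q_q flip: \<kappa>_power)
  then show ?case using Suc by (simp add: power_mult_distrib algebra_simps)
qed simp

lemma span_poly_sum: "poly (span_poly l) (\<Sum>i\<in>I. \<kappa> (c i) * x i) = (\<Sum>i\<in>I. \<kappa> (c i) * poly (span_poly l) (x i))"
  by (induction I rule: infinite_finite_induct) (simp_all add: span_poly_0 span_poly_add span_poly_scale)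

text \<open>The coefficient subtracted in the recursion is the one that makes both terms cancel at
  the newly added variable.\<close>

lemma span_poly_var: "i \<in> {1..l} \<Longrightarrow> poly (span_poly l) (\<xi> i) = 0"
proof (induction l)
  case (Suc l)
  show ?case
  proof (cases "i = Suc l")
    case True
    moreover have "poly (span_poly l) (\<xi> i) ^ (q ^ 2 - 1) * poly (span_poly l) (\<xi> i)
        = poly (span_poly l) (\<xi> i) ^ (q ^ 2)"
      using q_ge_2 by (intro power_minus_mult) simp
    ultimately show ?thesis by simp
  next
    case False
    then have "poly (span_poly l) (\<xi> i) = 0" using Suc by simp
    then show ?thesis using q_ge_2 by simp
  qed
qed simp

lemma span_poly_span: "v \<in> span_vars l \<Longrightarrow> poly (span_poly l) v = 0"
  by (auto simp: span_vars_def span_poly_sum span_poly_var intro!: sum.neutral)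

lemma span_poly_monic: "degree (span_poly l) = q ^ (2 * l)" "lead_coeff (span_poly l) = 1"
proof (induction l)
  case (Suc l)
  let ?P = "span_poly l ^ (q ^ 2)"
    and ?r = "smult (poly (span_poly l) (\<xi> (Suc l)) ^ (q ^ 2 - 1)) (span_poly l)"
  have nz: "span_poly l \<noteq> 0" using Suc by auto
  have dP: "degree ?P = q ^ (2 * Suc l)"
    using Suc(1) nz by (simp add: degree_power_eq power_add power2_eq_square mult_ac)
  have "degree ?r \<le> q ^ (2 * l)" using Suc(1) degree_smult_le by metis
  also have "\<dots> < q ^ (2 * Suc l)"
    using q_ge_2 by (intro power_strict_increasing) auto
  finally have r: "degree ?r < degree ?P" using dP by simp
  have "degree (span_poly (Suc l)) = degree ?P"
    unfolding span_poly.simps diff_conv_add_uminus using r by (intro degree_add_eq_left) simp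
  then show "degree (span_poly (Suc l)) = q ^ (2 * Suc l)" using dP by simp
  have "lead_coeff (span_poly (Suc l)) = coeff (?P - ?r) (degree ?P)"
    using \<open>degree (span_poly (Suc l)) = degree ?P\<close> by (simp only: span_poly.simps)
  also have "\<dots> = lead_coeff ?P" using coeff_eq_0[OF r] by (simp only: coeff_diff diff_zero)
  finally show "lead_coeff (span_poly (Suc l)) = 1" using Suc by (simp add: lead_coeff_power)
qed simp_all

lemma span_vars_0: "0 \<in> span_vars l"
  unfolding span_vars_def by (rule range_eqI[of _ _ "\<lambda>_. 0"]) (simp add: \<kappa>_0)

lemma span_vars_minus: "v \<in> span_vars l \<Longrightarrow> - v \<in> span_vars l"
proof -
  assume "v \<in> span_vars l"
  then obtain c where "v = (\<Sum>i=1..l. \<kappa> (c i) * \<xi> i)" by (auto simp: span_vars_def)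
  then have "- v = (\<Sum>i=1..l. \<kappa> (- c i) * \<xi> i)" by (simp add: \<kappa>_minus sum_negf)
  then show ?thesis unfolding span_vars_def by (rule range_eqI[where x = "\<lambda>i. - c i"])
qed

text \<open>Two equal values give a linear relation among the \<open>\<xi> i\<close>. A gap between
  \<open>l\<close> and \<open>j\<close> is allowed because the descent uses
  \<open>j = n - r\<close>.\<close>

lemma inj_span_vars:
  assumes "l < j" "j \<le> n"
  shows "inj_on (\<lambda>(v, c). v + \<kappa> c * \<xi> j) (span_vars l \<times> UNIV)"
proof -
  have "a = b \<and> v = w" if vw: "v \<in> span_vars l" "w \<in> span_vars l" "v + \<kappa> a * \<xi> j = w + \<kappa> b * \<xi> j" for v w a b
  proof -
    obtain c d where cd: "v = (\<Sum>i=1..l. \<kappa> (c i) * \<xi> i)" "w = (\<Sum>i=1..l. \<kappa> (d i) * \<xi> i)"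
      using vw(1,2) by (auto simp: span_vars_def)
    define f where "f i = (if i \<le> l then c i - d i else if i = j then a - b else 0)" for i
    have "(\<Sum>i=1..n. \<kappa> (f i) * \<xi> i) = (\<Sum>i\<in>insert j {1..l}. \<kappa> (f i) * \<xi> i)"
      using assms by (intro sum.mono_neutral_right) (auto simp: f_def \<kappa>_0)
    also have "\<dots> = \<kappa> (f j) * \<xi> j + (\<Sum>i=1..l. \<kappa> (f i) * \<xi> i)"
      using assms by (subst sum.insert) auto
    also have "\<dots> = (\<kappa> a - \<kappa> b) * \<xi> j + (v - w)"
      using assms by (simp add: f_def \<kappa>_diff cd sum_subtractf left_diff_distrib)
    also have "\<dots> = 0" using vw(3) by (simp add: algebra_simps)
    finally have "f j = 0" using indep[of f j] assms by simp
    then have "a = b" using assms by (simp add: f_def)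
    then show ?thesis using vw(3) by simp
  qed
  then show ?thesis by (auto simp: inj_on_def)
qed

lemma span_vars_Suc: "span_vars (Suc l) = (\<lambda>(v, c). v + \<kappa> c * \<xi> (Suc l)) ` (span_vars l \<times> UNIV)"
proof (intro equalityI subsetI)
  fix x assume "x \<in> span_vars (Suc l)"
  then obtain c where "x = (\<Sum>i=1..l. \<kappa> (c i) * \<xi> i) + \<kappa> (c (Suc l)) * \<xi> (Suc l)"
    by (auto simp: span_vars_def)
  then show "x \<in> (\<lambda>(v, c). v + \<kappa> c * \<xi> (Suc l)) ` (span_vars l \<times> UNIV)"
    by (auto simp: span_vars_def)
next
  fix x assume "x \<in> (\<lambda>(v, c). v + \<kappa> c * \<xi> (Suc l)) ` (span_vars l \<times> UNIV)"
  then obtain c d where x: "x = (\<Sum>i=1..l. \<kappa> (c i) * \<xi> i) + \<kappa> d * \<xi> (Suc l)"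
    by (auto simp: span_vars_def)
  have "x = (\<Sum>i=1..Suc l. \<kappa> ((c(Suc l := d)) i) * \<xi> i)"
    by (simp add: x)
  then show "x \<in> span_vars (Suc l)"
    unfolding span_vars_def by (rule range_eqI[where x = "c(Suc l := d)"])
qed

lemma card_span_vars: "l \<le> n \<Longrightarrow> finite (span_vars l) \<and> card (span_vars l) = q ^ (2 * l)"
proof (induction l)
  case (Suc l)
  then show ?case
    using card_image[OF inj_span_vars[of l "Suc l"]]
    by (simp add: span_vars_Suc card_cartesian_product card_a power_add power2_eq_square)
qed (simp add: span_vars_def)

text \<open>Both sides are monic of degree \<open>q ^ (2 * l)\<close> and vanish at the
  \<open>q ^ (2 * l)\<close> negatives of the span elements, more roots than a nonzero difference of
  smaller degree can have.\<close>

lemma span_poly_prod: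
  assumes "l \<le> n"
  shows "poly (span_poly l) t = (\<Prod>v\<in>span_vars l. t + v)"
proof -
  note V = card_span_vars[OF assms]
  define P where "P = (\<Prod>v\<in>span_vars l. [:v, 1:])"
  have dP: "degree P = q ^ (2 * l)"
    unfolding P_def using V by (subst degree_prod_eq_sum_degree) auto
  have lP: "lead_coeff P = 1"
    unfolding P_def by (simp add: lead_coeff_prod)
  have "span_poly l - P = 0"
  proof (rule ccontr)
    assume nz: "span_poly l - P \<noteq> 0"
    have "poly (span_poly l - P) (- v) = 0" if "v \<in> span_vars l" for v
    proof -
      have "poly P (- v) = 0" using that V by (auto simp: P_def poly_prod intro!: prod_zero)
      then show ?thesis using span_poly_span[OF span_vars_minus[OF that]] by simp
    qed
    then have "card (uminus ` span_vars l) \<le> card {x. poly (span_poly l - P) x = 0}"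
      by (intro card_mono poly_roots_finite[OF nz]) auto
    also have "\<dots> \<le> degree (span_poly l - P)" by (rule card_poly_roots_bound[OF nz])
    also have "\<dots> < q ^ (2 * l)"
    proof (rule degree_lessI)
      show "span_poly l - P \<noteq> 0 \<or> q ^ (2 * l) > 0" using nz by simp
      show "\<forall>k\<ge>q ^ (2 * l). coeff (span_poly l - P) k = 0"
        using dP lP span_poly_monic[of l] by (auto simp: le_less coeff_eq_0)
    qed
    finally show False using V by (simp add: card_image)
  qed
  then show ?thesis by (simp add: P_def poly_prod add.commute)
qed

text \<open>By the product formula a zero would put \<open>\<xi> j\<close> into the span of the
  first \<open>l\<close> variables. This keeps the leading coefficient in
  \<open>descent_step\<close> nonzero.\<close>

lemma span_poly_next_nonzero:
  assumes "l < j" "j \<le> n"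
  shows "poly (span_poly l) (\<xi> j) \<noteq> 0"
proof
  assume "poly (span_poly l) (\<xi> j) = 0"
  then obtain v where v: "v \<in> span_vars l" "\<xi> j + v = 0"
    using assms card_span_vars[of l] by (auto simp: span_poly_prod prod_zero_iff)
  have "v + \<kappa> 1 * \<xi> j = 0 + \<kappa> 0 * \<xi> j" using v(2) by (simp add: \<kappa>_0 \<kappa>_1 add.commute)
  then show False using inj_onD[OF inj_span_vars[OF assms], of "(v, 1)" "(0, 0)"] v span_vars_0 by auto
qed

lemma span_poly_coeffs:
  assumes "subfield_set S" "\<And>i. i \<in> {1..l} \<Longrightarrow> \<xi> i \<in> S"
  shows "coeffs_in S (span_poly l)"
  using assms(2)
proof (induction l)
  case 0
  then show ?case using assms(1) by (auto intro!: coeffs_in_ops subfield_setD)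
next
  case (Suc l)
  have IH: "coeffs_in S (span_poly l)" by (rule Suc.IH) (use Suc.prems in auto)
  then have "poly (span_poly l) (\<xi> (Suc l)) \<in> S"
    using Suc.prems by (intro poly_closed assms(1)) auto
  then show ?case using IH assms(1) by (auto intro!: coeffs_in_ops coeffs_in_power subfield_set_power)
qed

text \<open>Only exponents \<open>q ^ (2 * i)\<close> occur: the power \<open>q ^ 2\<close> in the
  recursion is additive and shifts the index \<open>i\<close> by one.\<close>

lemma span_poly_expand:
  assumes S: "subfield_set S" and \<xi>: "\<And>i. i \<in> {1..l} \<Longrightarrow> \<xi> i \<in> S"
  obtains c where "\<And>i. c i \<in> S" "\<And>z. poly (span_poly l) z = (\<Sum>i\<le>l. c i * z ^ (q ^ (2 * i)))"
proof -
  have "\<exists>c. (\<forall>i. c i \<in> S) \<and> (\<forall>z. poly (span_poly l) z = (\<Sum>i\<le>l. c i * z ^ (q ^ (2 * i))))"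
    using \<xi>
  proof (induction l)
    case 0
    then show ?case using subfield_setD[OF S] by (intro exI[of _ "\<lambda>_. 1"]) auto
  next
    case (Suc l)
    then obtain c where c: "\<And>i. c i \<in> S" "\<And>z. poly (span_poly l) z = (\<Sum>i\<le>l. c i * z ^ (q ^ (2 * i)))"
      by (metis atLeastAtMost_iff le_SucI)
    define d where "d = poly (span_poly l) (\<xi> (Suc l)) ^ (q ^ 2 - 1)"
    \<comment> \<open>The shifted coefficients minus \<open>d\<close> times the old ones; the case
      distinctions pad the two lists at opposite ends.\<close>
    define c' where "c' i = (if i = 0 then 0 else c (i - 1) ^ (q ^ 2)) - (if i \<le> l then d * c i else 0)" for i
    have "d \<in> S"
      unfolding d_def using Suc.prems S
      by (intro subfield_set_power poly_closed span_poly_coeffs) auto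
    then have "c' i \<in> S" for i
      using c(1) subfield_setD[OF S] subfield_set_power[OF S] by (auto simp: c'_def)
    moreover have "poly (span_poly (Suc l)) z = (\<Sum>i\<le>Suc l. c' i * z ^ (q ^ (2 * i)))" for z
    proof -
      have Q: "q ^ (2 * i) * q ^ 2 = q ^ (2 * Suc i)" for i by (simp flip: power_add)
      have "poly (span_poly l) z ^ (q ^ 2) = (\<Sum>i\<le>l. c i ^ (q ^ 2) * z ^ (q ^ (2 * Suc i)))"
        by (simp only: c(2) frob_sum power_mult_distrib power_mult[symmetric] Q)
      also have "\<dots> = (\<Sum>i\<le>Suc l. (if i = 0 then 0 else c (i - 1) ^ (q ^ 2)) * z ^ (q ^ (2 * i)))"
        by (simp add: sum.atMost_Suc_shift del: sum.atMost_Suc)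
      finally have 1: "poly (span_poly l) z ^ (q ^ 2) = \<dots>" .
      have 2: "d * poly (span_poly l) z = (\<Sum>i\<le>Suc l. (if i \<le> l then d * c i else 0) * z ^ (q ^ (2 * i)))"
        by (simp add: c(2) sum_distrib_left mult.assoc)
      show ?thesis
        unfolding span_poly.simps poly_diff poly_power poly_smult d_def[symmetric] 1 2
        by (simp only: c'_def left_diff_distrib sum_subtractf)
    qed
    ultimately show ?case by blast
  qed
  then show ?thesis using that by blast
qed

section \<open>Hermitian forms with Frobenius twist\<close>

text \<open>The polynomial \<open>h_k\<close> as one sum: the indices \<open>i\<close> and
  \<open>n + 1 - i\<close> give the paired terms and \<open>i = m + 1\<close> the middle
  one.\<close>

definition herm :: "nat \<Rightarrow> 'k" where
  "herm k = (\<Sum>i=1..n. \<xi> i * \<xi> (n + 1 - i) ^ (q ^ (2 * k - 1)))"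

text \<open>Taking out the smaller Frobenius power leaves an odd exponent \<open>2 * k - 1\<close>,
  with \<open>k = j - i + 1\<close> if \<open>i \<le> j\<close>. Otherwise \<open>k = i - j\<close>
  after reversing the sum. In both cases \<open>k \<le> m\<close>, so \<open>h_1, ..., h_m\<close>
  suffice.\<close>

lemma twisted_form_in:
  assumes S: "subfield_set S" and h: "\<And>k. k \<in> {1..m} \<Longrightarrow> herm k \<in> S" and ij: "i < m" "j < m"
  shows "(\<Sum>k=1..n. \<xi> k ^ (q ^ (2 * i)) * \<xi> (n + 1 - k) ^ (q ^ (2 * j + 1))) \<in> S"
proof (cases "i \<le> j")
  case True
  have "2 * (j - i + 1) - 1 + 2 * i = 2 * j + 1" using True by simp
  then have "q ^ (2 * (j - i + 1) - 1) * q ^ (2 * i) = q ^ (2 * j + 1)"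
    by (simp only: power_add[symmetric])
  then have "herm (j - i + 1) ^ (q ^ (2 * i))
      = (\<Sum>k=1..n. \<xi> k ^ (q ^ (2 * i)) * \<xi> (n + 1 - k) ^ (q ^ (2 * j + 1)))"
    by (simp only: herm_def frob_sum power_mult_distrib flip: power_mult)
  then show ?thesis
    using h[of "j - i + 1"] ij subfield_set_power[OF S] by (metis Suc_eq_plus1 Suc_le_eq atLeastAtMost_iff le_add2 less_imp_diff_less)
next
  case False
  have "2 * (i - j) - 1 + (2 * j + 1) = 2 * i" using False by simp
  then have "q ^ (2 * (i - j) - 1) * q ^ (2 * j + 1) = q ^ (2 * i)"
    by (simp only: power_add[symmetric])
  then have "herm (i - j) ^ (q ^ (2 * j + 1))
      = (\<Sum>k=1..n. \<xi> k ^ (q ^ (2 * j + 1)) * \<xi> (n + 1 - k) ^ (q ^ (2 * i)))"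
    by (simp only: herm_def frob_sum power_mult_distrib flip: power_mult)
  also have "\<dots> = (\<Sum>k=1..n. \<xi> k ^ (q ^ (2 * i)) * \<xi> (n + 1 - k) ^ (q ^ (2 * j + 1)))"
    by (rule sum.reindex_bij_witness[of _ "\<lambda>k. n + 1 - k" "\<lambda>k. n + 1 - k"]) auto
  finally have eq: "herm (i - j) ^ (q ^ (2 * j + 1)) = \<dots>" .
  show ?thesis
    unfolding eq[symmetric] using ij False by (intro subfield_set_power[OF S] h) auto
qed

text \<open>
  Let \<open>T\<close> be the additive polynomial with kernel spanned by \<open>\<xi>\<^sub>1, \<dots>, \<xi>\<^sub>l\<close>. In the twisted form
  evaluated at \<open>T(\<xi>)\<close> all terms with an index in \<open>{1..l}\<close> vanish, and expanding \<open>T\<close> expresses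
  the value by Frobenius powers of the invariants \<open>h\<^sub>k\<close>. What remains is an equation for
  \<open>\<xi> (n - l)\<close> over the preceding variables.
\<close>

lemma elimination:
  assumes S: "subfield_set S" and h: "\<And>k. k \<in> {1..m} \<Longrightarrow> herm k \<in> S" and l: "l < m"
    and \<xi>: "\<And>i. i \<in> {1..<n - l} \<Longrightarrow> \<xi> i \<in> S"
  defines "T \<equiv> poly (span_poly l)"
  shows "T (\<xi> (Suc l)) * T (\<xi> (n - l)) ^ q + T (\<xi> (Suc l)) ^ q * T (\<xi> (n - l)) \<in> S"
proof -
  note SD = subfield_setD[OF S]
  have Xl: "\<xi> i \<in> S" if "i \<in> {1..l}" for i using \<xi> that l n by auto
  obtain c where c: "\<And>i. c i \<in> S" "\<And>z. T z = (\<Sum>i\<le>l. c i * z ^ (q ^ (2 * i)))"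
    using span_poly_expand[OF S Xl] unfolding T_def by blast
  have Tq: "T z ^ q = (\<Sum>j\<le>l. c j ^ q * z ^ (q ^ (2 * j + 1)))" for z
    using frob_sum[of "\<lambda>i. c i * z ^ (q ^ (2 * i))" "{..l}" 1]
    by (simp add: c(2) power_mult_distrib mult.commute flip: power_mult)
  have "(\<Sum>k=1..n. T (\<xi> k) * T (\<xi> (n + 1 - k)) ^ q)
    = (\<Sum>k=1..n. \<Sum>i\<le>l. \<Sum>j\<le>l. c i * c j ^ q * (\<xi> k ^ (q ^ (2 * i)) * \<xi> (n + 1 - k) ^ (q ^ (2 * j + 1))))"
    unfolding Tq unfolding c(2) sum_product by (intro sum.cong refl) (simp only: mult_ac)
  also have "\<dots> = (\<Sum>i\<le>l. \<Sum>j\<le>l. c i * c j ^ q * (\<Sum>k=1..n. \<xi> k ^ (q ^ (2 * i)) * \<xi> (n + 1 - k) ^ (q ^ (2 * j + 1))))"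
    unfolding sum_distrib_left by (subst sum.swap, rule sum.cong[OF refl], rule sum.swap)
  also have "\<dots> \<in> S"
    using c(1) l by (intro subfield_set_sum[OF S] SD(4) subfield_set_power[OF S] twisted_form_in[OF S h]) auto
  finally have total: "(\<Sum>k=1..n. T (\<xi> k) * T (\<xi> (n + 1 - k)) ^ q) \<in> S" .
  have T0: "T (\<xi> i) = 0" if "i \<in> {1..l}" for i
    using span_poly_var[OF that] by (simp add: T_def)
  have TS: "T (\<xi> i) \<in> S" if "i \<in> {1..<n - l}" for i
    unfolding T_def by (intro poly_closed span_poly_coeffs S Xl \<xi> that)
  \<comment> \<open>If \<open>k \<le> l\<close> or \<open>k > n - l\<close>, one factor vanishes.
    All other \<open>k\<close> in this sum, as well as \<open>n + 1 - k\<close>, lie below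
    \<open>n - l\<close>, where the variables are in \<open>S\<close>.\<close>
  have rest: "(\<Sum>k\<in>{1..n} - {Suc l, n - l}. T (\<xi> k) * T (\<xi> (n + 1 - k)) ^ q) \<in> S"
  proof (rule subfield_set_sum[OF S])
    fix k assume k: "k \<in> {1..n} - {Suc l, n - l}"
    show "T (\<xi> k) * T (\<xi> (n + 1 - k)) ^ q \<in> S"
    proof (cases "k \<le> l \<or> n - l < k")
      case True
      then have "k \<in> {1..l} \<or> n + 1 - k \<in> {1..l}" using k by auto
      then have "T (\<xi> k) = 0 \<or> T (\<xi> (n + 1 - k)) = 0" using T0 by blast
      then show ?thesis using SD(1) q_ge_2 by (auto simp: power_0_left)
    next
      case False
      then show ?thesis using k by (intro SD(4) subfield_set_power[OF S] TS) auto
    qed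
  qed
  \<comment> \<open>These two indices are exchanged by \<open>k \<mapsto> n + 1 - k\<close>, and
    \<open>l < m\<close> makes them distinct.\<close>
  have "Suc l \<noteq> n - l" "Suc l \<in> {1..n}" "n - l \<in> {1..n}" "n + 1 - (n - l) = Suc l" "n + 1 - Suc l = n - l"
    using l n by auto
  then have "(\<Sum>k=1..n. T (\<xi> k) * T (\<xi> (n + 1 - k)) ^ q)
    = (\<Sum>k\<in>{1..n} - {Suc l, n - l}. T (\<xi> k) * T (\<xi> (n + 1 - k)) ^ q)
      + (T (\<xi> (Suc l)) * T (\<xi> (n - l)) ^ q + T (\<xi> (n - l)) * T (\<xi> (Suc l)) ^ q)"
    by (subst sum.subset_diff[of "{Suc l, n - l}"]) auto
  then have "T (\<xi> (Suc l)) * T (\<xi> (n - l)) ^ q + T (\<xi> (Suc l)) ^ q * T (\<xi> (n - l))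
    = (\<Sum>k=1..n. T (\<xi> k) * T (\<xi> (n + 1 - k)) ^ q)
      - (\<Sum>k\<in>{1..n} - {Suc l, n - l}. T (\<xi> k) * T (\<xi> (n + 1 - k)) ^ q)"
    by (simp add: mult.commute)
  then show ?thesis using SD(7)[OF total rest] by simp
qed

section \<open>Descent through the variables\<close>

text \<open>Matches degree and orbit size: \<open>q ^ (2 * r)\<close> for \<open>r \<le> m\<close>,
  and afterwards degree \<open>q * q ^ (2 * l)\<close> with \<open>l = n - 1 - r\<close>, where the
  trace kernel contributes the additional factor \<open>q\<close>.\<close>

lemma descent_step:
  assumes S: "subfield_set S" and E: "subfield_set E" "S \<subseteq> E" "\<xi> (Suc r) \<in> E"
    and r: "r < n" and Sx: "\<And>i. i \<in> {1..r} \<Longrightarrow> \<xi> i \<in> S"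
    and N: "r \<le> m \<Longrightarrow> poly (span_poly r) (\<xi> (Suc r)) \<in> S"
    and h: "\<And>k. k \<in> {1..m} \<Longrightarrow> herm k \<in> S"
    and f: "f \<in> field_gen (insert (\<xi> (Suc r)) S)"
    and hom: "\<And>v c. v \<in> span_vars (min r (n - 1 - r)) \<Longrightarrow> c ^ q + c = 0 \<Longrightarrow> (c \<noteq> 0 \<Longrightarrow> m < r) \<Longrightarrow>
      \<exists>\<sigma>. hom_on E \<sigma> \<and> (\<forall>s\<in>S. \<sigma> s = s) \<and> \<sigma> (\<xi> (Suc r)) = \<xi> (Suc r) + (v + \<kappa> c * \<xi> (n - r)) \<and> \<sigma> f = f"
  shows "f \<in> S"
proof -
  note SD = subfield_setD[OF S]
  define l where "l = min r (n - 1 - r)"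
  \<comment> \<open>For \<open>r \<le> m\<close> the variable \<open>\<xi> (n - r)\<close> does not
    precede \<open>\<xi> (Suc r)\<close>, so a unitriangular map cannot add a multiple of
    it.\<close>
  define C where "C = (if r \<le> m then {0} else {c::'a. c ^ q + c = 0})"
  define Z where "Z = (\<lambda>w. \<xi> (Suc r) + w) ` (\<lambda>(v, c). v + \<kappa> c * \<xi> (n - r)) ` (span_vars l \<times> C)"
  have ln: "l < n - r" "l \<le> n" using r by (auto simp: l_def)
  have inj: "inj_on (\<lambda>(v, c). v + \<kappa> c * \<xi> (n - r)) (span_vars l \<times> C)"
    by (rule inj_on_subset[OF inj_span_vars[OF ln(1)]]) auto
  have cardZ: "card Z = q ^ (2 * l) * card C"
    using card_span_vars[OF ln(2)]
    by (simp add: Z_def card_image card_image[OF inj] card_cartesian_product)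
  have homZ: "\<exists>\<sigma>. hom_on E \<sigma> \<and> (\<forall>s\<in>S. \<sigma> s = s) \<and> \<sigma> (\<xi> (Suc r)) = z \<and> \<sigma> f = f" if z: "z \<in> Z" for z
  proof -
    obtain v c where vc: "v \<in> span_vars l" "c \<in> C" "z = \<xi> (Suc r) + (v + \<kappa> c * \<xi> (n - r))"
      using z by (auto simp: Z_def)
    have "c ^ q + c = 0" "c \<noteq> 0 \<Longrightarrow> m < r"
      using vc(2) q_ge_2 by (auto simp: C_def power_0_left split: if_splits)
    then show ?thesis using hom[of v c] vc by (simp add: l_def)
  qed
  have Tc: "coeffs_in S (span_poly l)"
    using Sx by (intro span_poly_coeffs S) (auto simp: l_def)
  show ?thesis
  proof (cases "r \<le> m")
    case True
    then have l: "l = r" using n by (simp add: l_def)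
    define R where "R = span_poly r - [:poly (span_poly r) (\<xi> (Suc r)):]"
    have deg: "degree R = q ^ (2 * r)"
    proof -
      have "degree (- [:poly (span_poly r) (\<xi> (Suc r)):]) < degree (span_poly r)"
        using q_ge_2 by (simp add: span_poly_monic)
      then show ?thesis
        unfolding R_def diff_conv_add_uminus by (simp add: degree_add_eq_left span_poly_monic)
    qed
    have "coeffs_in S R"
      unfolding R_def using Tc N[OF True] l SD(1) by (auto intro!: coeffs_in_ops[OF S])
    moreover have "poly R (\<xi> (Suc r)) = 0" by (simp add: R_def)
    moreover have "degree R \<le> card Z" "degree R > 0"
      using deg cardZ True l q_ge_2 by (simp_all add: C_def)
    ultimately show ?thesis
      using descent[OF S E _ _ _ _ f homZ] by blast
  next
    case False
    then have l: "l = n - 1 - r" "l < m" "n - l = Suc r" using r n by (auto simp: l_def)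
    define a where "a = poly (span_poly l) (\<xi> (Suc l))"
    define P where "P = smult a (span_poly l ^ q)"
    define P' where "P' = smult (a ^ q) (span_poly l)"
    \<comment> \<open>The constant term is the value that \<open>elimination\<close> places in
      \<open>S\<close>; the grouping puts the leading part \<open>P\<close> first so that the degree
      can be read off.\<close>
    define R where "R = P + (P' - [:poly (P + P') (\<xi> (Suc r)):])"
    have a: "a \<noteq> 0" "a \<in> S"
    proof -
      show "a \<noteq> 0" unfolding a_def using l n by (intro span_poly_next_nonzero) auto
      show "a \<in> S" unfolding a_def using l n False by (intro poly_closed S Tc Sx) auto
    qed
    have nz: "span_poly l \<noteq> 0" using span_poly_monic(2)[of l] by auto
    have dP: "degree P = q * q ^ (2 * l)"
      using a nz by (simp add: P_def degree_power_eq span_poly_monic)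
    have deg: "degree R = q * q ^ (2 * l)"
    proof -
      have "degree (P' - [:poly (P + P') (\<xi> (Suc r)):]) \<le> q ^ (2 * l)"
        using degree_smult_le[of "a ^ q" "span_poly l"]
        by (intro degree_diff_le) (auto simp: P'_def span_poly_monic)
      also have "\<dots> < degree P" using q_ge_2 by (simp add: dP)
      finally show ?thesis unfolding R_def by (simp add: degree_add_eq_left dP)
    qed
    have "poly (P + P') (\<xi> (Suc r)) \<in> S"
      using elimination[OF S h l(2)] Sx l(3)
      by (simp add: P_def P'_def a_def[symmetric] atLeastLessThanSuc_atLeastAtMost)
    then have "coeffs_in S R"
      unfolding R_def P_def P'_def using Tc a SD(1)
      by (auto intro!: coeffs_in_ops[OF S] coeffs_in_power[OF S] subfield_set_power[OF S])
    moreover have "poly R (\<xi> (Suc r)) = 0" by (simp add: R_def)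
    moreover have "degree R \<le> card Z" "degree R > 0"
      using deg cardZ False card_trace_kernel q_ge_2 by (simp_all add: C_def)
    ultimately show ?thesis
      using descent[OF S E _ _ _ _ f homZ] by blast
  qed
qed

text \<open>Iterates \<open>descent_step\<close> down the chain \<open>F n, ..., F 0\<close>, where
  \<open>F n\<close> contains \<open>f\<close> and \<open>F 0\<close> is contained in
  \<open>L\<close>.\<close>

lemma invariant_in_subfield:
  assumes L: "subfield_set L" and f: "f \<in> field_gen (L \<union> \<xi> ` {1..n})"
    and N: "\<And>j. j \<in> {1..m + 1} \<Longrightarrow> poly (span_poly (j - 1)) (\<xi> j) \<in> L"
    and h: "\<And>k. k \<in> {1..m} \<Longrightarrow> herm k \<in> L"
    and E: "subfield_set E" "L \<union> \<xi> ` {1..n} \<subseteq> E"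
    and hom: "\<And>r v c. r < n \<Longrightarrow> v \<in> span_vars (min r (n - 1 - r)) \<Longrightarrow> c ^ q + c = 0 \<Longrightarrow>
      (c \<noteq> 0 \<Longrightarrow> m < r) \<Longrightarrow> \<exists>\<sigma>. hom_on E \<sigma> \<and> (\<forall>s\<in>L. \<sigma> s = s) \<and> (\<forall>i\<in>{1..r}. \<sigma> (\<xi> i) = \<xi> i)
        \<and> \<sigma> (\<xi> (Suc r)) = \<xi> (Suc r) + (v + \<kappa> c * \<xi> (n - r)) \<and> \<sigma> f = f"
  shows "f \<in> L"
proof -
  define F where "F r = field_gen (L \<union> \<xi> ` {1..r})" for r
  have LF: "L \<union> \<xi> ` {1..r} \<subseteq> F r" for r unfolding F_def by (rule field_gen_superset)
  have step: "f \<in> F r" if r: "r < n" and fr: "f \<in> F (Suc r)" for r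
  proof (rule descent_step)
    show SF: "subfield_set (F r)" unfolding F_def by (rule subfield_set_field_gen)
    show "F r \<subseteq> E" unfolding F_def using E r by (intro field_gen_minimal) auto
    have "F (Suc r) \<subseteq> field_gen (insert (\<xi> (Suc r)) (F r))"
      unfolding F_def[of "Suc r"]
    proof (rule field_gen_minimal[OF subfield_set_field_gen])
      have "L \<union> \<xi> ` {1..Suc r} \<subseteq> insert (\<xi> (Suc r)) (F r)"
        using LF[of r] by (auto simp: atLeastAtMostSuc_conv)
      then show "L \<union> \<xi> ` {1..Suc r} \<subseteq> field_gen (insert (\<xi> (Suc r)) (F r))"
        using field_gen_superset by blast
    qed
    then show "f \<in> field_gen (insert (\<xi> (Suc r)) (F r))" using fr by blast
    fix v :: 'k and c :: 'a assume vc: "v \<in> span_vars (min r (n - 1 - r))" "c ^ q + c = 0" "c \<noteq> 0 \<Longrightarrow> m < r"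
    obtain \<sigma> where \<sigma>: "hom_on E \<sigma>" "\<forall>s\<in>L. \<sigma> s = s" "\<forall>i\<in>{1..r}. \<sigma> (\<xi> i) = \<xi> i"
      "\<sigma> (\<xi> (Suc r)) = \<xi> (Suc r) + (v + \<kappa> c * \<xi> (n - r))" "\<sigma> f = f"
      using hom[OF r vc] by blast
    \<comment> \<open>The elements fixed by \<open>\<sigma>\<close> form a subfield, so it is enough
      that \<open>\<sigma>\<close> fixes the generators of \<open>F r\<close>.\<close>
    have "F r \<subseteq> {x \<in> E. \<sigma> x = x}"
      unfolding F_def using E r \<sigma> subfield_setD(2)[OF L]
      by (intro field_gen_minimal hom_on_fixed_subfield) auto
    then show "\<exists>\<sigma>. hom_on E \<sigma> \<and> (\<forall>s\<in>F r. \<sigma> s = s)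
        \<and> \<sigma> (\<xi> (Suc r)) = \<xi> (Suc r) + (v + \<kappa> c * \<xi> (n - r)) \<and> \<sigma> f = f"
      using \<sigma> by blast
  next
    show "poly (span_poly r) (\<xi> (Suc r)) \<in> F r" if "r \<le> m"
      using N[of "Suc r"] that LF[of r] by auto
    show "herm k \<in> F r" if "k \<in> {1..m}" for k
      using h[OF that] LF[of r] by auto
  qed (use E r LF[of r] in auto)
  have "f \<in> F 0"
    by (rule inc_induct[of 0 n "\<lambda>r. f \<in> F r"]) (use f step in \<open>auto simp: F_def\<close>)
  then show ?thesis
    unfolding F_def using field_gen_minimal[OF L] by auto
qed

section \<open>Invariance of the generators\<close>

text \<open>A triangular \<open>\<sigma>\<close> moves \<open>\<xi> (Suc l)\<close> by an element of
  the kernel of \<open>D_l\<close>, so it fixes \<open>D_l(\<xi> (Suc l))\<close>, the coefficient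
  used in the recursion.\<close>

lemma hom_span_poly:
  assumes E: "subfield_set E" "\<xi> ` {1..n} \<subseteq> E" and \<sigma>: "hom_on E \<sigma>" "\<sigma> 1 = 1"
    and tri: "\<And>j. j \<in> {1..n} \<Longrightarrow> \<sigma> (\<xi> j) - \<xi> j \<in> span_vars (j - 1)"
    and l: "l \<le> n" and z: "z \<in> E"
  shows "\<sigma> (poly (span_poly l) z) = poly (span_poly l) (\<sigma> z)"
  using l z
proof (induction l arbitrary: z)
  case (Suc l)
  note hom = hom_onD[OF E(1) \<sigma>] and ED = subfield_setD[OF E(1)]
  have TE: "poly (span_poly l) y \<in> E" if "y \<in> E" for y
    using that E Suc.prems(1) by (intro poly_closed span_poly_coeffs E(1)) auto
  have x: "\<xi> (Suc l) \<in> E" using E(2) Suc.prems(1) by auto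
  have "\<sigma> (poly (span_poly l) (\<xi> (Suc l)))
      = poly (span_poly l) (\<xi> (Suc l) + (\<sigma> (\<xi> (Suc l)) - \<xi> (Suc l)))"
    using Suc.IH[OF _ x] Suc.prems(1) by simp
  also have "\<dots> = poly (span_poly l) (\<xi> (Suc l))"
    using span_poly_span[OF tri[of "Suc l"]] Suc.prems(1) unfolding span_poly_add by simp
  finally show ?case
    using Suc TE x by (simp add: hom ED subfield_set_power[OF E(1)])
qed simp

lemma span_poly_var_invariant:
  assumes E: "subfield_set E" "\<xi> ` {1..n} \<subseteq> E" and \<sigma>: "hom_on E \<sigma>" "\<sigma> 1 = 1"
    and tri: "\<And>j. j \<in> {1..n} \<Longrightarrow> \<sigma> (\<xi> j) - \<xi> j \<in> span_vars (j - 1)"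
    and j: "j \<in> {1..n}"
  shows "\<sigma> (poly (span_poly (j - 1)) (\<xi> j)) = poly (span_poly (j - 1)) (\<xi> j)"
proof -
  have "\<sigma> (poly (span_poly (j - 1)) (\<xi> j)) = poly (span_poly (j - 1)) (\<xi> j + (\<sigma> (\<xi> j) - \<xi> j))"
    unfolding add_diff_eq add_diff_cancel_left' using E(2) j by (intro hom_span_poly[OF E \<sigma> tri]) auto
  also have "\<dots> = poly (span_poly (j - 1)) (\<xi> j)"
    unfolding span_poly_add[of _ "\<xi> j"] using span_poly_span[OF tri[OF j]] by simp
  finally show ?thesis .
qed

text \<open>On constants the power \<open>q ^ 2\<close> is the identity, so only the parity of the
  exponent of \<open>q\<close> matters.\<close>

lemma power_odd_frobenius: "k \<ge> 1 \<Longrightarrow> (c::'a) ^ (q ^ (2 * k - 1)) = c ^ q"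
proof (induction k rule: dec_induct)
  case (step k)
  then have "2 * Suc k - 1 = (2 * k - 1) + 2" by simp
  then have "c ^ (q ^ (2 * Suc k - 1)) = ((c ^ (q ^ (2 * k - 1))) ^ q) ^ q"
    by (simp only: power_add power_mult power2_eq_square)
  then show ?case using step.IH by (simp add: power_q_q)
qed simp

text \<open>Constants are twisted by \<open>c ^ q\<close> for every \<open>k\<close>, so the one
  unitarity relation handles all \<open>herm k\<close>: after substitution only the pairs with
  \<open>a + b = n + 1\<close> survive.\<close>

lemma herm_invariant:
  assumes E: "subfield_set E" "\<xi> ` {1..n} \<subseteq> E" and \<sigma>: "hom_on E \<sigma>" "\<sigma> 1 = 1"
    and U: "\<And>i. i \<in> {1..n} \<Longrightarrow> \<sigma> (\<xi> i) = (\<Sum>a=1..n. \<kappa> (U i a) * \<xi> a)"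
    and unitary: "\<And>a b. a \<in> {1..n} \<Longrightarrow> b \<in> {1..n} \<Longrightarrow>
      (\<Sum>i=1..n. U i a * U (n + 1 - i) b ^ q) = of_bool (a + b = n + 1)"
    and k: "k \<ge> 1"
  shows "\<sigma> (herm k) = herm k"
proof -
  let ?Q = "q ^ (2 * k - 1)"
  note hom = hom_onD[OF E(1) \<sigma>] and ED = subfield_setD[OF E(1)]
  have xE: "\<xi> i \<in> E" if "i \<in> {1..n}" for i using E(2) that by auto
  have \<kappa>_sum: "\<kappa> (\<Sum>i\<in>I. f i) = (\<Sum>i\<in>I. \<kappa> (f i))" for f :: "nat \<Rightarrow> 'a" and I
    by (induction I rule: infinite_finite_induct) (simp_all add: \<kappa>_0 \<kappa>_add)
  have "\<sigma> (herm k) = (\<Sum>i=1..n. \<sigma> (\<xi> i * \<xi> (n + 1 - i) ^ ?Q))"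
    unfolding herm_def by (intro hom ED(4) subfield_set_power[OF E(1)] xE) auto
  also have "\<dots> = (\<Sum>i=1..n. \<sigma> (\<xi> i) * \<sigma> (\<xi> (n + 1 - i)) ^ ?Q)"
  proof (intro sum.cong refl)
    fix i assume "i \<in> {1..n}"
    then have "i \<in> {1..n}" "n + 1 - i \<in> {1..n}" by auto
    then have "\<xi> i \<in> E" "\<xi> (n + 1 - i) \<in> E" by (simp_all only: xE)
    then show "\<sigma> (\<xi> i * \<xi> (n + 1 - i) ^ ?Q) = \<sigma> (\<xi> i) * \<sigma> (\<xi> (n + 1 - i)) ^ ?Q"
      by (simp add: hom subfield_set_power[OF E(1)])
  qed
  also have "\<dots> = (\<Sum>i=1..n. \<Sum>a=1..n. \<Sum>b=1..n. \<kappa> (U i a * U (n + 1 - i) b ^ q) * (\<xi> a * \<xi> b ^ ?Q))"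
  proof (intro sum.cong refl)
    fix i assume "i \<in> {1..n}"
    then have i: "i \<in> {1..n}" "n + 1 - i \<in> {1..n}" by auto
    show "\<sigma> (\<xi> i) * \<sigma> (\<xi> (n + 1 - i)) ^ ?Q
      = (\<Sum>a=1..n. \<Sum>b=1..n. \<kappa> (U i a * U (n + 1 - i) b ^ q) * (\<xi> a * \<xi> b ^ ?Q))"
      unfolding U[OF i(1)] U[OF i(2)] frob_sum sum_product power_mult_distrib \<kappa>_power[symmetric]
        power_odd_frobenius[OF k] \<kappa>_mult
      by (simp only: mult_ac)
  qed
  also have "\<dots> = (\<Sum>a=1..n. \<Sum>b=1..n. \<Sum>i=1..n. \<kappa> (U i a * U (n + 1 - i) b ^ q) * (\<xi> a * \<xi> b ^ ?Q))"
    by (subst sum.swap, rule sum.cong[OF refl], rule sum.swap)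
  also have "\<dots> = (\<Sum>a=1..n. \<Sum>b=1..n. if b = n + 1 - a then \<xi> a * \<xi> b ^ ?Q else 0)"
  proof (intro sum.cong refl)
    fix a b assume ab: "a \<in> {1..n}" "b \<in> {1..n}"
    then have "a + b = n + 1 \<longleftrightarrow> b = n + 1 - a" by auto
    then show "(\<Sum>i=1..n. \<kappa> (U i a * U (n + 1 - i) b ^ q) * (\<xi> a * \<xi> b ^ ?Q))
        = (if b = n + 1 - a then \<xi> a * \<xi> b ^ ?Q else 0)"
      unfolding sum_distrib_right[symmetric] \<kappa>_sum[symmetric] unitary[OF ab]
      by (simp add: \<kappa>_0 \<kappa>_1)
  qed
  also have "\<dots> = herm k"
    unfolding herm_def by (intro sum.cong refl) (subst sum.delta, auto)
  finally show ?thesis .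
qed

end

section \<open>The action on polynomials and fractions\<close>

lemma mconst_ops:
  "mconst (a + b) = mconst a + mconst b" "mconst (a * b) = mconst a * mconst b"
  "mconst 0 = 0" "mconst 1 = 1"
  by (simp_all add: mconst_def single_add mult_single)

lemma msubst_eq_sum:
  assumes "finite A" "Poly_Mapping.keys f \<subseteq> A"
  shows "msubst \<sigma> f = (\<Sum>\<mu>\<in>A. mconst (Poly_Mapping.lookup f \<mu>) *
      (\<Prod>i\<in>Poly_Mapping.keys \<mu>. \<sigma> i ^ Poly_Mapping.lookup \<mu> i))"
  unfolding msubst_def using assms
  by (intro sum.mono_neutral_left) (auto simp: in_keys_iff mconst_ops)

lemma poly_act_add: "poly_act n g (a + b) = poly_act n g a + poly_act n g b"
proof -
  let ?A = "Poly_Mapping.keys a \<union> Poly_Mapping.keys b"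
  have "Poly_Mapping.keys (a + b) \<subseteq> ?A" by (rule keys_add)
  then show ?thesis
    unfolding poly_act_def
    by (simp add: msubst_eq_sum[of ?A] lookup_add mconst_ops sum.distrib distrib_right)
qed

lemma poly_act_mconst: "poly_act n g (mconst c) = mconst c"
  unfolding poly_act_def by (subst msubst_eq_sum[of "{0}"]) (simp_all add: mconst_def)

lemma poly_act_mvar:
  fixes g :: "'a::comm_ring_1 mat"
  shows "poly_act n g (mvar j) = (\<Sum>k=1..n.
    mconst ((inv\<^bsub>ring_mat TYPE('a) n ()\<^esub> g) $$ (j - 1, k - 1)) * mvar k)"
  unfolding poly_act_def
  by (subst msubst_eq_sum[of "{Poly_Mapping.single j 1}"]) (simp_all add: mvar_def mconst_ops)

lemma poly_ring_mconst: "mconst c \<in> poly_ring n"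
  by (simp add: mconst_def poly_ring_def)

lemma poly_ring_mvar: "j \<in> {1..n} \<Longrightarrow> mvar j \<in> poly_ring n"
  by (simp add: mvar_def poly_ring_def)

lemma poly_ring_add: "a \<in> poly_ring n \<Longrightarrow> b \<in> poly_ring n \<Longrightarrow> a + b \<in> poly_ring n"
  using keys_add[of a b] by (auto simp: poly_ring_def)

lemma poly_ring_mult: "a \<in> poly_ring n \<Longrightarrow> b \<in> poly_ring n \<Longrightarrow> a * b \<in> poly_ring n"
proof -
  assume ab: "a \<in> poly_ring n" "b \<in> poly_ring n"
  show ?thesis
    unfolding poly_ring_def
  proof (intro CollectI ballI)
    fix \<mu> assume "\<mu> \<in> Poly_Mapping.keys (a * b)"
    then obtain \<nu> \<rho> where *: "\<nu> \<in> Poly_Mapping.keys a" "\<rho> \<in> Poly_Mapping.keys b" "\<mu> = \<nu> + \<rho>"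
      using keys_mult[of a b] by auto
    then show "Poly_Mapping.keys \<mu> \<subseteq> {1..n}"
      using ab keys_add[of \<nu> \<rho>] by (fastforce simp: poly_ring_def)
  qed
qed

lemma poly_ring_sum: "(\<And>i. i \<in> I \<Longrightarrow> f i \<in> poly_ring n) \<Longrightarrow> sum f I \<in> poly_ring n"
proof (induction I rule: infinite_finite_induct)
  case (insert x F)
  then show ?case by (simp add: poly_ring_add)
qed (simp_all add: poly_ring_def)

lemma poly_ring_power: "a \<in> poly_ring n \<Longrightarrow> a ^ k \<in> poly_ring n"
  by (induction k) (simp_all add: poly_ring_mult, simp add: poly_ring_def)

lemma poly_ring_prod: "(\<And>i. i \<in> I \<Longrightarrow> f i \<in> poly_ring n) \<Longrightarrow> prod f I \<in> poly_ring n"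
proof (induction I rule: infinite_finite_induct)
  case (insert x F)
  then show ?case by (simp add: poly_ring_mult)
qed (use poly_ring_mconst[of 1 n] in \<open>simp_all add: mconst_ops\<close>)

lemma poly_act_in_poly_ring: "poly_act n g f \<in> poly_ring n"
  unfolding poly_act_def msubst_def
  by (intro poly_ring_sum poly_ring_mult poly_ring_mconst poly_ring_prod poly_ring_power poly_ring_mvar)

text \<open>Exhibits \<open>f\<close> as built from constants and variables, which places
  \<open>to_fract f\<close> in the field they generate.\<close>

lemma mpoly_expansion:
  "f = (\<Sum>\<mu>\<in>Poly_Mapping.keys f. mconst (Poly_Mapping.lookup f \<mu>) *
    (\<Prod>i\<in>Poly_Mapping.keys \<mu>. mvar i ^ Poly_Mapping.lookup \<mu> i))"
proof -
  have pow: "mvar j ^ k = Poly_Mapping.single (Poly_Mapping.single j k) (1::'a)" for j k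
    by (induction k) (simp_all add: mvar_def mult_single flip: single_add)
  have prod: "(\<Prod>i\<in>I. Poly_Mapping.single (F i) (1::'a)) = Poly_Mapping.single (\<Sum>i\<in>I. F i) 1"
    for I :: "nat set" and F :: "nat \<Rightarrow> nat \<Rightarrow>\<^sub>0 nat"
    by (induction I rule: infinite_finite_induct) (simp_all add: mult_single)
  have expand: "(\<Sum>\<mu>\<in>Poly_Mapping.keys h. Poly_Mapping.single \<mu> (Poly_Mapping.lookup h \<mu>)) = h"
    for h :: "'x \<Rightarrow>\<^sub>0 'y::comm_monoid_add"
    by (rule poly_mapping_eqI) (simp add: lookup_sum lookup_single when_def in_keys_iff)
  show ?thesis by (simp add: pow prod expand mconst_def mult_single)
qed

text \<open>Read off the coefficient at the monomial \<open>x_i\<close>.\<close>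

lemma mvar_independent:
  assumes "(\<Sum>i=1..n. mconst (c i) * mvar i) = 0" and "i \<in> {1..n}"
  shows "c i = 0"
proof -
  have inj: "Poly_Mapping.single j (1::nat) = Poly_Mapping.single i 1 \<longleftrightarrow> j = i" for j
    by (metis lookup_single_eq lookup_single_not_eq one_neq_zero)
  have "0 = Poly_Mapping.lookup (\<Sum>j=1..n. mconst (c j) * mvar j) (Poly_Mapping.single i 1)"
    using assms(1) by simp
  also have "\<dots> = (\<Sum>j=1..n. if j = i then c j else 0)"
    by (simp add: lookup_sum mconst_def mvar_def mult_single lookup_single when_def inj[unfolded One_nat_def])
  also have "\<dots> = c i" using assms(2) by simp
  finally show ?thesis by simp
qed

abbreviation frac_const :: "'a::idom \<Rightarrow> 'a mpoly fract" where
  "frac_const c \<equiv> to_fract (mconst c)"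

abbreviation frac_var :: "nat \<Rightarrow> 'a::idom mpoly fract" where
  "frac_var j \<equiv> to_fract (mvar j)"

lemma to_fract_sum: "to_fract (sum f I) = (\<Sum>i\<in>I. to_fract (f i))"
  by (induction I rule: infinite_finite_induct) simp_all

lemma to_fract_prod: "to_fract (prod f I) = (\<Prod>i\<in>I. to_fract (f i))"
  by (induction I rule: infinite_finite_induct) simp_all

lemma to_fract_power: "to_fract (a ^ k) = to_fract a ^ k"
  by (induction k) simp_all

lemma fun_field_iff:
  "r \<in> fun_field n \<longleftrightarrow> (\<exists>a\<in>poly_ring n. \<exists>b\<in>poly_ring n. b \<noteq> 0 \<and> r = to_fract a / to_fract b)"
  by (auto simp: fun_field_def Fract_conv_to_fract)

lemma fract_in_fun_field:
  "a \<in> poly_ring n \<Longrightarrow> b \<in> poly_ring n \<Longrightarrow> b \<noteq> 0 \<Longrightarrow> to_fract a / to_fract b \<in> fun_field n"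
  by (auto simp: fun_field_iff)

lemma to_fract_in_fun_field: "a \<in> poly_ring n \<Longrightarrow> to_fract a \<in> fun_field n"
  using fract_in_fun_field[of a n 1] poly_ring_mconst[of 1 n] by (simp add: mconst_ops)

lemma subfield_set_fun_field: "subfield_set (fun_field n)"
  unfolding subfield_set_def
proof (intro conjI ballI)
  show "1 \<in> fun_field n"
    using to_fract_in_fun_field[OF poly_ring_mconst[of 1 n]] by (simp add: mconst_ops)
next
  fix r s :: "'a mpoly fract" assume "r \<in> fun_field n" "s \<in> fun_field n"
  then obtain a b c d where *: "a \<in> poly_ring n" "b \<in> poly_ring n" "b \<noteq> 0" "r = to_fract a / to_fract b"
    "c \<in> poly_ring n" "d \<in> poly_ring n" "d \<noteq> 0" "s = to_fract c / to_fract d"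
    unfolding fun_field_iff by blast
  have eq: "r + s = to_fract (a * d + c * b) / to_fract (b * d)" "r * s = to_fract (a * c) / to_fract (b * d)"
    using * by (simp_all add: add_frac_eq)
  have "b * d \<noteq> 0" "b * d \<in> poly_ring n" "a * d + c * b \<in> poly_ring n" "a * c \<in> poly_ring n"
    using * by (auto intro: poly_ring_add poly_ring_mult)
  then show "r + s \<in> fun_field n" "r * s \<in> fun_field n"
    unfolding eq by (blast intro: fract_in_fun_field)+
next
  fix r :: "'a mpoly fract" assume "r \<in> fun_field n"
  then obtain a b where *: "a \<in> poly_ring n" "b \<in> poly_ring n" "b \<noteq> 0" "r = to_fract a / to_fract b"
    unfolding fun_field_iff by blast
  have "mconst (- 1) * a = - a"
    by (metis add_eq_0_iff mconst_ops(1,3,4) mult_minus1 add.right_inverse)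
  then have "- a \<in> poly_ring n" using poly_ring_mult[OF poly_ring_mconst[of "- 1" n] *(1)] by simp
  then show "- r \<in> fun_field n" using fract_in_fun_field[of "- a" n b] * by simp
  show "inverse r \<in> fun_field n"
  proof (cases "a = 0")
    case True
    then show ?thesis using * \<open>r \<in> fun_field n\<close> by simp
  next
    case False
    then show ?thesis using fract_in_fun_field[of b n a] * by simp
  qed
qed

lemma fun_field_subset_gen: "fun_field n \<subseteq> field_gen (range frac_const \<union> frac_var ` {1..n})"
proof
  let ?F = "field_gen (range frac_const \<union> frac_var ` {1..n})"
  have F: "subfield_set ?F" by (rule subfield_set_field_gen)
  have gen: "range frac_const \<union> frac_var ` {1..n} \<subseteq> ?F" by (rule field_gen_superset)
  have poly: "to_fract a \<in> ?F" if "a \<in> poly_ring n" for a :: "'a mpoly"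
  proof -
    have "to_fract a = (\<Sum>\<mu>\<in>Poly_Mapping.keys a. frac_const (Poly_Mapping.lookup a \<mu>) *
        (\<Prod>i\<in>Poly_Mapping.keys \<mu>. frac_var i ^ Poly_Mapping.lookup \<mu> i))"
      by (subst mpoly_expansion[of a]) (simp add: to_fract_sum to_fract_prod to_fract_power)
    also have "\<dots> \<in> ?F"
    proof (intro subfield_set_sum[OF F] subfield_setD(4)[OF F] subfield_set_prod[OF F] subfield_set_power[OF F])
      show "frac_const c \<in> ?F" for c using gen by blast
      show "frac_var i \<in> ?F" if "\<mu> \<in> Poly_Mapping.keys a" "i \<in> Poly_Mapping.keys \<mu>" for \<mu> i
      proof -
        have "i \<in> {1..n}" using that \<open>a \<in> poly_ring n\<close> unfolding poly_ring_def by blast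
        then show ?thesis using gen by blast
      qed
    qed
    finally show ?thesis .
  qed
  fix r :: "'a mpoly fract" assume "r \<in> fun_field n"
  then show "r \<in> ?F"
    using poly subfield_setD(8)[OF F] by (auto simp: fun_field_iff)
qed

lemma fract_act_div:
  fixes g :: "'a::idom mat"
  assumes "g \<in> Units (ring_mat TYPE('a) n ())" "a \<in> poly_ring n" "b \<in> poly_ring n" "b \<noteq> 0"
  shows "fract_act n g (to_fract a / to_fract b) = to_fract (poly_act n g a) / to_fract (poly_act n g b)"
  using fract_act_Fract[OF assms] by (simp add: Fract_conv_to_fract)

lemma fract_act_to_fract:
  fixes g :: "'a::idom mat"
  assumes "g \<in> Units (ring_mat TYPE('a) n ())" "a \<in> poly_ring n"
  shows "fract_act n g (to_fract a) = to_fract (poly_act n g a)"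
  using fract_act_div[OF assms poly_ring_mconst[of 1]] poly_act_mconst[of n g 1] by (simp add: mconst_ops)

lemma hom_on_fract_act:
  fixes g :: "'a::idom mat"
  assumes g: "g \<in> Units (ring_mat TYPE('a) n ())"
  shows "hom_on (fun_field n) (fract_act n g)" "fract_act n g 1 = 1"
proof -
  \<comment> \<open>The action of the inverse matrix undoes that of \<open>g\<close>, so
    denominators stay nonzero.\<close>
  have nz: "poly_act n g c \<noteq> 0" if "c \<in> poly_ring n" "c \<noteq> 0" for c
    using poly_act_inverse[OF g that(1)] that(2) by (auto simp: poly_act_def msubst_def)
  show "hom_on (fun_field n) (fract_act n g)"
    unfolding hom_on_def
  proof (intro ballI)
    fix r s :: "'a mpoly fract" assume "r \<in> fun_field n" "s \<in> fun_field n"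
    then obtain a b c d where *: "a \<in> poly_ring n" "b \<in> poly_ring n" "b \<noteq> 0" "r = to_fract a / to_fract b"
      "c \<in> poly_ring n" "d \<in> poly_ring n" "d \<noteq> 0" "s = to_fract c / to_fract d"
      unfolding fun_field_iff by blast
    have eq: "r + s = to_fract (a * d + c * b) / to_fract (b * d)" "r * s = to_fract (a * c) / to_fract (b * d)"
      using * by (simp_all add: add_frac_eq)
    have "b * d \<noteq> 0" "b * d \<in> poly_ring n" "a * d + c * b \<in> poly_ring n" "a * c \<in> poly_ring n"
      using * by (auto intro: poly_ring_add poly_ring_mult)
    then have
      "fract_act n g (r + s) = to_fract (poly_act n g (a * d + c * b)) / to_fract (poly_act n g (b * d))"
      "fract_act n g (r * s) = to_fract (poly_act n g (a * c)) / to_fract (poly_act n g (b * d))"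
      unfolding eq by (blast intro: fract_act_div[OF g])+
    then show "fract_act n g (r + s) = fract_act n g r + fract_act n g s \<and>
      fract_act n g (r * s) = fract_act n g r * fract_act n g s"
      using * nz[of b] nz[of d]
      by (simp add: fract_act_div[OF g] poly_act_add poly_act_mult add_frac_eq)
  qed
  show "fract_act n g 1 = 1"
    using fract_act_to_fract[OF g poly_ring_mconst[of 1]] poly_act_mconst[of n g 1] by (simp add: mconst_ops)
qed

section \<open>Invariants of the unitary group\<close>

context
  fixes p e q m n :: nat and G :: "'a::{finite,field} mat set"
  assumes p: "prime p" and e: "e \<ge> 1" and q: "q = p ^ e"
    and card_a: "card (UNIV :: 'a set) = q ^ 2" and n: "n = 2 * m + 1"
    and G: "G = unitary_unitriangular q n"
begin

interpretation hermitian_field p e q m n "frac_const :: 'a \<Rightarrow> 'a mpoly fract" frac_var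
proof
  fix c :: "nat \<Rightarrow> 'a" and i
  assume *: "(\<Sum>i=1..n. frac_const (c i) * frac_var i) = 0" and i: "i \<in> {1..n}"
  have "to_fract (\<Sum>i=1..n. mconst (c i) * mvar i) = 0" using * by (simp add: to_fract_sum)
  then show "c i = 0" using mvar_independent[OF _ i] by (simp only: to_fract_eq_0_iff)
qed (use p e q card_a n in \<open>simp_all add: mconst_ops\<close>)

lemma G_Units: "g \<in> G \<Longrightarrow> g \<in> Units (ring_mat TYPE('a) n ())"
  using unitary_hstar(3)[OF power_q_q] by (simp add: G)

lemma G_hom:
  assumes "g \<in> G"
  shows "hom_on (fun_field n) (fract_act n g)" "fract_act n g 1 = 1"
  using hom_on_fract_act[OF G_Units[OF assms]] .

text \<open>The action substitutes the rows of the inverse matrix, and the inverse of a unitary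
  \<open>g\<close> is \<open>hstar q n g\<close>.\<close>

lemma act_var:
  assumes "g \<in> G" "j \<in> {1..n}"
  shows "fract_act n g (frac_var j) = (\<Sum>k=1..n. frac_const (hstar q n g $$ (j - 1, k - 1)) * frac_var k)"
  using fract_act_to_fract[OF G_Units[OF assms(1)] poly_ring_mvar[OF assms(2)]] unitary_hstar(4)[OF power_q_q] assms(1)
  by (simp add: G poly_act_mvar to_fract_sum)

lemma vars_in_fun_field: "(frac_var ` {1..n} :: 'a mpoly fract set) \<subseteq> fun_field n"
  using poly_ring_mvar to_fract_in_fun_field by blast

lemma act_triangular:
  assumes g: "g \<in> G" and j: "j \<in> {1..n}"
  shows "fract_act n g (frac_var j) - frac_var j \<in> span_vars (j - 1)"
proof -
  let ?U = "hstar q n g"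
  have "?U \<in> lower_unitriangular n"
    using unitary_hstar(1)[OF power_q_q, of g n] g by (simp add: G unitary_unitriangular_def)
  then have low: "?U $$ (j - 1, k - 1) = 0" if "j < k" "k \<le> n" for k
    using j that by (auto simp: lower_unitriangular_def)
  have diag: "?U $$ (j - 1, j - 1) = 1"
    using \<open>?U \<in> lower_unitriangular n\<close> j by (auto simp: lower_unitriangular_def)
  have "fract_act n g (frac_var j) = (\<Sum>k\<in>{1..j}. frac_const (?U $$ (j - 1, k - 1)) * frac_var k)"
    unfolding act_var[OF g j] using j low
    by (intro sum.mono_neutral_right) (auto simp: mconst_ops)
  also have "{1..j} = insert j {1..j - 1}" using j by auto
  also have "(\<Sum>k\<in>insert j {1..j - 1}. frac_const (?U $$ (j - 1, k - 1)) * frac_var k)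
      = frac_var j + (\<Sum>k=1..j - 1. frac_const (?U $$ (j - 1, k - 1)) * frac_var k)"
    using j by (subst sum.insert) (auto simp: diag[unfolded One_nat_def] mconst_ops)
  finally show ?thesis by (auto simp: span_vars_def)
qed

text \<open>Supplies the orbit points for the descent: a group element fixing
  \<open>x_1, ..., x_r\<close> and translating the next variable as prescribed.\<close>

lemma act_transvection:
  assumes r: "r < n" and v: "v \<in> span_vars (min r (n - 1 - r))"
    and c: "c ^ q + c = 0" "c \<noteq> 0 \<Longrightarrow> m < r"
  obtains g where "g \<in> G" "\<And>i. i \<in> {1..r} \<Longrightarrow> fract_act n g (frac_var i) = frac_var i"
    "fract_act n g (frac_var (Suc r)) = frac_var (Suc r) + (v + frac_const c * frac_var (n - r))"
proof -
  define s where "s = n - 1 - r"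
  obtain d where d: "v = (\<Sum>i=1..min r s. frac_const (d i) * frac_var i)"
    using v by (auto simp: span_vars_def s_def)
  \<comment> \<open>The coefficients of \<open>v\<close>, shifted from variable indices starting at
    1 to matrix indices starting at 0.\<close>
  define a where "a k = (if k < min r s then d (Suc k) else 0)" for k
  obtain \<mu> :: 'a where \<mu>: "\<mu> ^ q + \<mu> = - of_bool (r = s)"
  proof (cases "r = s")
    case True
    then show ?thesis using trace_minus_1 that by auto
  next
    case False
    then show ?thesis using that[of 0] q_ge_2 by (simp add: power_0_left)
  qed
  have char: "prime CHAR('a)" "q = CHAR('a) ^ e" using p q by (simp_all add: CHAR_a)
  have cs: "c \<noteq> 0 \<Longrightarrow> s < r" using c(2) n by (auto simp: s_def)
  have a: "a k \<noteq> 0 \<Longrightarrow> k < min r s" for k by (auto simp: a_def split: if_splits)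
  note trans = transvection_unitary[where a = a, OF char power_q_q r s_def c(1) cs \<mu> a]
  define h where "h = mat n n (\<lambda>(k, i). of_bool (k = i) + (a i + c * of_bool (i = s)) * of_bool (k = r)
      + (\<mu> * a i - of_bool (i = s)) * a (n - 1 - k) ^ q)"
  note h = trans[folded h_def]
  \<comment> \<open>The action of \<open>g\<close> reads the rows of its inverse, so
    \<open>g\<close> is taken to be the inverse of the transvection \<open>h\<close>.\<close>
  define g where "g = hstar q n h"
  have g: "g \<in> G" "hstar q n g = h"
    using unitary_hstar(1,2)[OF power_q_q h(1)] by (simp_all add: g_def G)
  show ?thesis
  proof (rule that[OF g(1)])
    fix i assume i: "i \<in> {1..r}"
    then have "fract_act n g (frac_var i) = (\<Sum>k=1..n. frac_const (h $$ (i - 1, k - 1)) * frac_var k)"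
      using act_var[OF g(1), of i] r by (simp add: g(2))
    also have "\<dots> = (\<Sum>k=1..n. if k = i then frac_var k else 0)"
      using i r by (intro sum.cong refl) (subst h(2), auto simp: mconst_ops)
    also have "\<dots> = frac_var i" using i r by simp
    finally show "fract_act n g (frac_var i) = frac_var i" .
  next
    have "fract_act n g (frac_var (Suc r)) = (\<Sum>k=1..n. frac_const (h $$ (r, k - 1)) * frac_var k)"
      using act_var[OF g(1), of "Suc r"] r by (simp add: g(2))
    also have "\<dots> = (\<Sum>k=1..n. (if k = Suc r then frac_var k else 0)
        + (frac_const (a (k - 1)) * frac_var k + (if k = n - r then frac_const c * frac_var k else 0)))"
    proof (intro sum.cong refl)
      fix k assume k: "k \<in> {1..n}"
      then have "r = k - 1 \<longleftrightarrow> k = Suc r" "k - 1 = s \<longleftrightarrow> k = n - r" "k - 1 < n"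
        using r by (auto simp: s_def)
      then show "frac_const (h $$ (r, k - 1)) * frac_var k = (if k = Suc r then frac_var k else 0)
        + (frac_const (a (k - 1)) * frac_var k + (if k = n - r then frac_const c * frac_var k else 0))"
        by (simp add: h(3) mconst_ops distrib_right)
    qed
    also have "\<dots> = frac_var (Suc r)
        + ((\<Sum>k=1..n. frac_const (a (k - 1)) * frac_var k) + frac_const c * frac_var (n - r))"
      using r by (simp add: sum.distrib)
    also have "(\<Sum>k=1..n. frac_const (a (k - 1)) * frac_var k) = v"
      unfolding d using r by (intro sum.mono_neutral_cong_right) (auto simp: a_def mconst_ops)
    finally show "fract_act n g (frac_var (Suc r)) = frac_var (Suc r) + (v + frac_const c * frac_var (n - r))" .
  qed
qed

text \<open>For \<open>j \<le> m + 1\<close> the orbit is the full coset of \<open>x_j\<close>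
  modulo the span of the earlier variables: triangularity gives one inclusion, transvections with
  \<open>c = 0\<close> the other.\<close>

lemma orbit_prod_eq_span_poly:
  assumes j: "j \<in> {1..m + 1}"
  shows "to_fract (orbit_prod n G j) = poly (span_poly (j - 1)) (frac_var j)"
proof -
  have jn: "j \<in> {1..n}" "j - 1 \<le> n" using j n by auto
  let ?O = "(\<lambda>g. poly_act n g (mvar j)) ` G"
  have act: "to_fract (poly_act n g (mvar j)) = fract_act n g (frac_var j)" if "g \<in> G" for g
    using fract_act_to_fract[OF G_Units[OF that] poly_ring_mvar[OF jn(1)]] by simp
  have "to_fract ` ?O = (\<lambda>v. frac_var j + v) ` span_vars (j - 1)"
  proof (intro equalityI subsetI)
    fix y assume "y \<in> to_fract ` ?O"
    then obtain g where "g \<in> G" "y = fract_act n g (frac_var j)" using act by auto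
    then show "y \<in> (\<lambda>v. frac_var j + v) ` span_vars (j - 1)"
      using act_triangular[OF _ jn(1), of g] by (intro image_eqI[of _ _ "y - frac_var j"]) auto
  next
    fix y assume "y \<in> (\<lambda>v. frac_var j + v) ` span_vars (j - 1)"
    then obtain v where v: "v \<in> span_vars (j - 1)" "y = frac_var j + v" by blast
    have "min (j - 1) (n - 1 - (j - 1)) = j - 1" "j - 1 < n" "Suc (j - 1) = j" using j n by auto
    then obtain g where "g \<in> G" "fract_act n g (frac_var j) = frac_var j + (v + frac_const 0 * frac_var (n - (j - 1)))"
      using act_transvection[of "j - 1" v 0] v(1) q_ge_2 by (auto simp: power_0_left)
    then show "y \<in> to_fract ` ?O" using act v(2) by (auto simp: mconst_ops image_iff intro!: bexI[of _ g])
  qed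
  moreover have "to_fract (orbit_prod n G j) = \<Prod>(to_fract ` ?O)"
    unfolding orbit_prod_def to_fract_prod by (subst prod.reindex) (auto simp: inj_on_def)
  ultimately have "to_fract (orbit_prod n G j) = \<Prod>((\<lambda>v. frac_var j + v) ` span_vars (j - 1))"
    by simp
  also have "\<dots> = (\<Prod>v\<in>span_vars (j - 1). frac_var j + v)"
    by (subst prod.reindex) (auto simp: inj_on_def)
  also have "\<dots> = poly (span_poly (j - 1)) (frac_var j)"
    by (rule span_poly_prod[OF jn(2), symmetric])
  finally show ?thesis .
qed

lemma h_poly_eq_herm: "to_fract (h_poly q m k) = herm k"
proof -
  let ?t = "\<lambda>i. frac_var i * frac_var (n + 1 - i) ^ (q ^ (2 * k - 1)) :: 'a mpoly fract"
  have "{1..n} = {1..m} \<union> (insert (m + 1) {m + 2..n})" using n by auto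
  then have "herm k = (\<Sum>i=1..m. ?t i) + (?t (m + 1) + (\<Sum>i=m + 2..n. ?t i))"
    unfolding herm_def by (simp only:) (subst sum.union_disjoint, auto)
  also have "(\<Sum>i=m + 2..n. ?t i) = (\<Sum>i=1..m. ?t (n + 1 - i))"
    by (rule sum.reindex_bij_witness[of _ "\<lambda>i. n + 1 - i" "\<lambda>i. n + 1 - i"]) (use n in auto)
  also have "\<dots> = (\<Sum>i=1..m. frac_var (n + 1 - i) * frac_var i ^ (q ^ (2 * k - 1)))"
    using n by (intro sum.cong refl) auto
  also have "?t (m + 1) = frac_var (m + 1) ^ (q ^ (2 * k - 1) + 1)"
    using n by simp
  finally show ?thesis
    using n by (simp add: h_poly_def to_fract_sum to_fract_power sum.distrib mult_ac add_ac)
qed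

lemma subfield_set_invariant_field: "subfield_set (invariant_field n G)"
proof -
  note F = subfield_setD[OF subfield_set_fun_field[where 'a = 'a and n = n]]
  show ?thesis
    unfolding subfield_set_def invariant_field_def
    using F G_hom(2) hom_onD[OF subfield_set_fun_field G_hom] by auto
qed

text \<open>Invariance is read off from the additive polynomial instead of from a permutation of the
  orbit.\<close>

lemma orbit_prod_invariant:
  assumes "j \<in> {1..m + 1}"
  shows "to_fract (orbit_prod n G j) \<in> invariant_field n G"
proof -
  have j: "j \<in> {1..n}" using assms n by auto
  have "to_fract (orbit_prod n G j) \<in> fun_field n"
    unfolding orbit_prod_def
    by (intro to_fract_in_fun_field poly_ring_prod) (auto intro: poly_act_in_poly_ring)
  moreover have "fract_act n g (to_fract (orbit_prod n G j)) = to_fract (orbit_prod n G j)" if "g \<in> G" for g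
    unfolding orbit_prod_eq_span_poly[OF assms]
    by (rule span_poly_var_invariant[OF subfield_set_fun_field vars_in_fun_field G_hom[OF that] act_triangular[OF that] j])
  ultimately show ?thesis by (simp add: invariant_field_def)
qed

lemma h_poly_invariant:
  assumes k: "k \<ge> 1"
  shows "to_fract (h_poly q m k) \<in> invariant_field n G"
proof -
  have "to_fract (h_poly q m k) \<in> fun_field n"
    unfolding h_poly_def
    by (intro to_fract_in_fun_field poly_ring_add poly_ring_sum poly_ring_mult poly_ring_power poly_ring_mvar)
      (auto simp: n)
  moreover have "fract_act n g (herm k) = herm k" if g: "g \<in> G" for g
  proof (rule herm_invariant[OF subfield_set_fun_field vars_in_fun_field G_hom[OF g] act_var[OF g] _ k])
    fix a b assume ab: "a \<in> {1..n}" "b \<in> {1..n}"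
    let ?U = "hstar q n g"
    have "?U \<in> unitary_unitriangular q n" using unitary_hstar(1)[OF power_q_q] g by (simp add: G)
    then have "(\<Sum>i<n. ?U $$ (i, a - 1) * ?U $$ (n - 1 - i, b - 1) ^ q) = of_bool (a - 1 + (b - 1) = n - 1)"
      using unitary_iff_hstar(1)[where g = ?U and n = n and q = q] ab
      by (auto simp: unitary_unitriangular_def)
    also have "(\<Sum>i<n. ?U $$ (i, a - 1) * ?U $$ (n - 1 - i, b - 1) ^ q)
        = (\<Sum>i=1..n. ?U $$ (i - 1, a - 1) * ?U $$ (n + 1 - i - 1, b - 1) ^ q)"
      by (rule sum.reindex_bij_witness[of _ "\<lambda>i. i - 1" Suc]) auto
    also have "a - 1 + (b - 1) = n - 1 \<longleftrightarrow> a + b = n + 1" using ab by auto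
    finally show "(\<Sum>i=1..n. ?U $$ (i - 1, a - 1) * ?U $$ (n + 1 - i - 1, b - 1) ^ q) = of_bool (a + b = n + 1)" .
  qed
  ultimately show ?thesis by (simp add: invariant_field_def flip: h_poly_eq_herm)
qed

text \<open>One inclusion is the invariance of the generators. The other is
  \<open>invariant_in_subfield\<close> with \<open>E = fun_field n\<close>, where the homomorphisms
  come from \<open>act_transvection\<close>.\<close>

lemma invariant_field_eq_field_adjoin:
  "invariant_field n G = field_adjoin (orbit_prod n G ` {1..m + 1} \<union> h_poly q m ` {1..m})"
proof
  let ?S = "range mconst \<union> (orbit_prod n G ` {1..m + 1} \<union> h_poly q m ` {1..m})"
  let ?L = "field_gen (to_fract ` ?S)"
  have gen: "to_fract ` ?S \<subseteq> ?L" by (rule field_gen_superset)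
  have L: "subfield_set ?L" by (rule subfield_set_field_gen)
  have const: "frac_const c \<in> invariant_field n G" for c
    using to_fract_in_fun_field[OF poly_ring_mconst] fract_act_to_fract[OF G_Units poly_ring_mconst]
    by (simp add: invariant_field_def poly_act_mconst)
  have LK: "?L \<subseteq> invariant_field n G"
    using const orbit_prod_invariant h_poly_invariant
    by (intro field_gen_minimal subfield_set_invariant_field) auto
  then show "field_adjoin (orbit_prod n G ` {1..m + 1} \<union> h_poly q m ` {1..m}) \<subseteq> invariant_field n G"
    by (simp add: field_adjoin_def)
  show "invariant_field n G \<subseteq> field_adjoin (orbit_prod n G ` {1..m + 1} \<union> h_poly q m ` {1..m})"
    unfolding field_adjoin_def
  proof
    fix f assume f: "f \<in> invariant_field n G"
    show "f \<in> ?L"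
    proof (rule invariant_in_subfield[OF L _ _ _ subfield_set_fun_field[of n]])
      have "range frac_const \<union> frac_var ` {1..n} \<subseteq> ?L \<union> frac_var ` {1..n}" using gen by auto
      then show "f \<in> field_gen (?L \<union> frac_var ` {1..n})"
        using f fun_field_subset_gen field_gen_mono unfolding invariant_field_def by blast
      show "poly (span_poly (j - 1)) (frac_var j) \<in> ?L" if "j \<in> {1..m + 1}" for j
        using gen that unfolding orbit_prod_eq_span_poly[OF that, symmetric] by auto
      show "herm k \<in> ?L" if "k \<in> {1..m}" for k
        using gen that unfolding h_poly_eq_herm[symmetric] by auto
      show "?L \<union> frac_var ` {1..n} \<subseteq> fun_field n"
        using LK vars_in_fun_field by (auto simp: invariant_field_def)
      fix r and c :: 'a and v :: "'a mpoly fract"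
      assume *: "r < n" "v \<in> span_vars (min r (n - 1 - r))" "c ^ q + c = 0" "c \<noteq> 0 \<Longrightarrow> m < r"
      obtain g where g: "g \<in> G" "\<And>i. i \<in> {1..r} \<Longrightarrow> fract_act n g (frac_var i) = frac_var i"
        "fract_act n g (frac_var (Suc r)) = frac_var (Suc r) + (v + frac_const c * frac_var (n - r))"
        using act_transvection[OF *] by metis
      have "\<forall>s\<in>?L. fract_act n g s = s" "fract_act n g f = f"
        using LK f g(1) by (auto simp: invariant_field_def)
      then show "\<exists>\<sigma>. hom_on (fun_field n) \<sigma> \<and> (\<forall>s\<in>?L. \<sigma> s = s) \<and> (\<forall>i\<in>{1..r}. \<sigma> (frac_var i) = frac_var i)
          \<and> \<sigma> (frac_var (Suc r)) = frac_var (Suc r) + (v + frac_const c * frac_var (n - r)) \<and> \<sigma> f = f"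
        using G_hom(1)[OF g(1)] g by blast
    qed
  qed
qed

end

theorem theorem4p12:
  fixes p e q m :: nat
    and G :: "'a::{finite,field} mat set"
  assumes "prime p" and "e \<ge> 1" and "q = p ^ e"
    and "card (UNIV :: 'a set) = q ^ 2"
    and "m \<ge> 1"
    and "G = unitary_unitriangular q (2 * m + 1)"
  shows "invariant_field (2 * m + 1) G =
    field_adjoin (orbit_prod (2 * m + 1) G ` {1..m + 1} \<union> h_poly q m ` {1..m})"
  using invariant_field_eq_field_adjoin[OF assms(1-4) refl assms(6)] .

end
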